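(* Let $G$ be a finite simple graph. If $G$ is not the disjoint union of at least one cycle with at most one path, then \[p_{2,\mathrm{top}}(G) = \max\left\{\frac{v_{\mathrm{odd}}(G)}{2}, \left\lceil \frac{\Delta(G)}{2}\right \rceil\right\}.\]
   Context: All graphs are finite and simple. A path odd-cover of a graph $G=(V,E)$ is a collection of paths in the complete graph on $V$ (i.e. paths whose vertex sets are contained in $V$) whose edge sets have symmetric difference equal to $E$; $p_2(G)$ is the minimum cardinality of a path odd-cover of $G$. A subdivision of $G$ is a graph obtained by repeatedly replacing edges by paths with new internal vertices. $p_{2,\mathrm{top}}(G)$ is the minimum of $p_2(H)$ over all subdivisions $H$ of $G$ (including $G$ itself). $\Delta(G)$ is the maximum degree of $G$ and $v_{\mathrm{odd}}(G)$ is the number of vertices of odd degree in $G$.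
   Formalization: The exclusion of disjoint unions of at least one cycle with at most one path is applied after deleting isolated vertices, since the formula fails, for example, for a triangle with two isolated vertices (right side 1, but no subdivision is a single path). *)

theory Defs
  imports Complex_Main "HOL-Library.Infinite_Typeclass"
begin

datatype 'a graph = Graph (verts: "'a set") (edges: "'a set set")

definition simple_graph :: "'a graph \<Rightarrow> bool" where
  "simple_graph G \<longleftrightarrow>
     finite (verts G) \<and> (\<forall>e\<in>edges G. e \<subseteq> verts G \<and> card e = 2)"

definition degree :: "'a graph \<Rightarrow> 'a \<Rightarrow> nat" where
  "degree G v = card {e \<in> edges G. v \<in> e}"

text \<open>On the natural numbers the supremum of a finite set is its maximum, and it is 0 for the
  empty set, so the graph without vertices has maximum degree 0.\<close>

definition max_degree :: "'a graph \<Rightarrow> nat" where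
  "max_degree G = (SUP v\<in>verts G. degree G v)"

definition v_odd :: "'a graph \<Rightarrow> nat" where
  "v_odd G = card {v \<in> verts G. odd (degree G v)}"

definition consecutive_edges :: "'a list \<Rightarrow> 'a set set" where
  "consecutive_edges xs = {{xs ! i, xs ! Suc i} | i. Suc i < length xs}"

definition is_path :: "'a graph \<Rightarrow> bool" where
  "is_path P \<longleftrightarrow>
     (\<exists>xs. xs \<noteq> [] \<and> distinct xs \<and> P = Graph (set xs) (consecutive_edges xs))"

definition is_cycle :: "'a graph \<Rightarrow> bool" where
  "is_cycle C \<longleftrightarrow>
     (\<exists>xs. length xs \<ge> 3 \<and> distinct xs \<and>
        C = Graph (set xs) (insert {last xs, hd xs} (consecutive_edges xs)))"

text \<open>The symmetric difference of a family of edge sets consists of the edges that lie in an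
  odd number of members. A path is a graph here, so a vertex sequence and its reversal give the
  same path. Only the vertices of a path are restricted, as its edges need not be edges of \<open>G\<close>.\<close>

definition path_odd_cover :: "'a graph \<Rightarrow> 'a graph set \<Rightarrow> bool" where
  "path_odd_cover G \<P> \<longleftrightarrow>
     finite \<P> \<and> (\<forall>P\<in>\<P>. is_path P \<and> verts P \<subseteq> verts G) \<and>
     {e. odd (card {P \<in> \<P>. e \<in> edges P})} = edges G"

text \<open>For a simple graph the minimum is over a nonempty set, since the single edges
  form a path odd-cover.\<close>

definition p2 :: "'a graph \<Rightarrow> nat" where
  "p2 G = (LEAST k. \<exists>\<P>. path_odd_cover G \<P> \<and> card \<P> = k)"

inductive subdivision :: "'a graph \<Rightarrow> 'a graph \<Rightarrow> bool" for G where
  refl: "subdivision G G"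
| step: "\<lbrakk>subdivision G H; {u, v} \<in> edges H; distinct xs; set xs \<inter> verts H = {}\<rbrakk> \<Longrightarrow>
    subdivision G (Graph (verts H \<union> set xs)
      ((edges H - {{u, v}}) \<union> consecutive_edges (u # xs @ [v])))"

text \<open>The vertex type is infinite so that new subdivision vertices never run out.\<close>

definition p2_top :: "'a::infinite graph \<Rightarrow> nat" where
  "p2_top G = (LEAST k. \<exists>H. subdivision G H \<and> p2 H = k)"

text \<open>Used to disregard isolated vertices when excluding the disjoint unions of cycles with at
  most one path. If they counted as path components, a triangle with two isolated vertices would
  not be excluded, although the formula gives 1 and no subdivision has the edge set of a
  single path.\<close>

definition delete_isolated :: "'a graph \<Rightarrow> 'a graph" where
  "delete_isolated G = Graph {v \<in> verts G. degree G v \<noteq> 0} (edges G)"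

definition cycles_and_at_most_one_path :: "'a graph \<Rightarrow> bool" where
  "cycles_and_at_most_one_path G \<longleftrightarrow>
     (\<exists>\<C> \<Q>. \<C> \<noteq> {} \<and> (\<forall>C\<in>\<C>. is_cycle C) \<and>
        finite \<Q> \<and> card \<Q> \<le> 1 \<and> (\<forall>Q\<in>\<Q>. is_path Q) \<and>
        pairwise (\<lambda>A B. disjnt (verts A) (verts B)) (\<C> \<union> \<Q>) \<and>
        G = Graph (\<Union>A\<in>\<C> \<union> \<Q>. verts A) (\<Union>A\<in>\<C> \<union> \<Q>. edges A))"

end

theory Submission
  imports Defs
begin

text \<open>Subdividing an edge changes neither the degrees nor the number of odd vertices among the old
  vertices. A path contributes at most 2 to a degree, and an odd vertex must be an end of some path
  of the cover, whence the lower bound \<open>k = max (v_odd G / 2) \<lceil>max_degree G / 2\<rceil>\<close>.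

  For \<open>k \<ge> 2\<close>, draw \<open>k\<close> paths visiting the vertices of \<open>G\<close> so that every vertex gets the right degree.
  Their sum is a union of strands, i.e. paths through new vertices between vertices of \<open>G\<close>, but
  the strands join the wrong pairs. If the edge \<open>ab\<close> of one strand belongs to the path \<open>P\<close> only,
  and the edge \<open>cd\<close> of another strand belongs to the path \<open>Q \<noteq> P\<close> only, then replacing \<open>ab\<close> by \<open>axyb\<close>
  in \<open>P\<close> and \<open>cd\<close> by \<open>cyxd\<close> in \<open>Q\<close>, with new vertices \<open>x\<close> and \<open>y\<close>, cancels \<open>xy\<close>, so the strands become
  \<open>\<dots>axd\<dots>\<close> and \<open>\<dots>cyb\<dots>\<close>: they have swapped their tails. Such swaps turn any pairing of strand ends
  into the one given by the edges of \<open>G\<close>. For \<open>k = 1\<close> the graph \<open>G\<close> consists of disjoint cycles, at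
  most one path and isolated vertices.\<close>

section \<open>Edges of paths\<close>

abbreviation ce :: "'a list \<Rightarrow> 'a set set" where
  "ce \<equiv> consecutive_edges"

lemma ce_Nil [simp]: "ce [] = {}" and ce_single [simp]: "ce [x] = {}"
  by (auto simp: consecutive_edges_def)

lemma ce_Cons_Cons [simp]: "ce (x # y # zs) = insert {x, y} (ce (y # zs))"
proof -
  have "{i. Suc i < length (x # y # zs)} = insert 0 (Suc ` {i. Suc i < length (y # zs)})"
    by (auto simp: image_iff gr0_conv_Suc less_Suc_eq_0_disj)
  then have "(\<lambda>i. {(x # y # zs) ! i, (x # y # zs) ! Suc i}) ` {i. Suc i < length (x # y # zs)}
      = insert {x, y} ((\<lambda>i. {(y # zs) ! i, (y # zs) ! Suc i}) ` {i. Suc i < length (y # zs)})"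
    by (simp add: image_image)
  then show ?thesis
    unfolding consecutive_edges_def by (simp add: setcompr_eq_image)
qed

lemma ce_append:
  "xs \<noteq> [] \<Longrightarrow> ys \<noteq> [] \<Longrightarrow> ce (xs @ ys) = ce xs \<union> {{last xs, hd ys}} \<union> ce ys"
proof (induction xs rule: induct_list012)
  case (2 x)
  then show ?case by (cases ys) auto
qed auto

lemma ce_append_single:
  assumes "xs \<noteq> []" "zs \<noteq> []"
  shows "ce (xs @ [y] @ zs) = ce xs \<union> {{last xs, y}, {y, hd zs}} \<union> ce zs"
proof -
  have "ce ([y] @ zs) = {{y, hd zs}} \<union> ce zs"
    using ce_append[of "[y]" zs] assms by simp
  then show ?thesis
    using ce_append[of xs "[y] @ zs"] assms by auto
qed

lemma ce_rev [simp]: "ce (rev xs) = ce xs"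
proof (induction xs)
  case (Cons x xs)
  then show ?case
    using ce_append[of "rev xs" "[x]"]
    by (cases xs) (auto simp: last_rev insert_commute simp del: rev.simps(2) simp: rev.simps(2)[of x])
qed simp

lemma ce_subset_set: "e \<in> ce xs \<Longrightarrow> e \<subseteq> set xs"
  by (induction xs rule: induct_list012) auto

lemma finite_ce [simp]: "finite (ce xs)"
  by (induction xs rule: induct_list012) auto

lemma card_of_ce: "distinct xs \<Longrightarrow> e \<in> ce xs \<Longrightarrow> card e = 2"
  by (induction xs rule: induct_list012) auto

text \<open>Turns an edge into a cut of the list. This is how paths and strands are opened for
  rerouting.\<close>

lemma ce_splitE:
  assumes "e \<in> ce xs"
  obtains ys zs where "xs = ys @ zs" "ys \<noteq> []" "zs \<noteq> []" "e = {last ys, hd zs}"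
  using assms
proof (induction xs arbitrary: thesis rule: induct_list012)
  case (3 x y zs)
  show ?case
  proof (cases "e = {x, y}")
    case True
    show ?thesis by (rule 3(3)[of "[x]" "y # zs"]) (use True in auto)
  next
    case False
    then have "e \<in> ce (y # zs)" using 3(4) by simp
    then obtain us vs where "y # zs = us @ vs" "us \<noteq> []" "vs \<noteq> []" "e = {last us, hd vs}"
      by (rule 3(2)[rotated])
    then show ?thesis by (intro 3(3)[of "x # us" vs]) auto
  qed
qed auto

section \<open>Vertex degrees along a single path\<close>

definition path_degree :: "'a list \<Rightarrow> 'a \<Rightarrow> nat" where
  "path_degree xs v = card {e \<in> ce xs. v \<in> e}"

text \<open>Each end of a path lacks one of the two edges that an inner vertex has. The sum form
  avoids subtraction on the natural numbers and includes the one-vertex path, where both corrections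
  fall on the same vertex. In the induction the edge at the new head is new because the head does
  not occur later.\<close>

lemma path_degree_eq:
  assumes "distinct xs" "xs \<noteq> []"
  shows "path_degree xs v + of_bool (v = hd xs) + of_bool (v = last xs) =
    (if v \<in> set xs then 2 else 0)"
  using assms
proof (induction xs rule: induct_list012)
  case (3 x y zs)
  have "{x, y} \<notin> ce (y # zs)"
    using 3(3) ce_subset_set[of "{x, y}" "y # zs"] by auto
  moreover have "{e \<in> ce (x # y # zs). v \<in> e} =
      (if v = x \<or> v = y then insert {x, y} {e \<in> ce (y # zs). v \<in> e} else {e \<in> ce (y # zs). v \<in> e})"
    by auto
  ultimately have "path_degree (x # y # zs) v = of_bool (v = x \<or> v = y) + path_degree (y # zs) v"
    by (auto simp: path_degree_def)
  then show ?case using 3 by (auto split: if_splits)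
qed (auto simp: path_degree_def)

lemma path_degree_le:
  assumes "distinct xs"
  shows "path_degree xs v \<le> 2"
proof (cases "xs = []")
  case False
  have "path_degree xs v \<le> (if v \<in> set xs then 2 else 0)"
    using path_degree_eq[OF assms False, of v] by linarith
  then show ?thesis by (simp split: if_splits)
qed (simp add: path_degree_def)

text \<open>Reroutes one edge of a path through new vertices. The conclusion mentions only vertex
  and edge sets, so later arguments need not know in which direction the path runs through the
  edge.\<close>

lemma splice_path:
  assumes "distinct p" "{a, b} \<in> ce p" "distinct ys" "ys \<noteq> []" "set ys \<inter> set p = {}"
  obtains q where "distinct q" "set q = set p \<union> set ys"
    "ce q = (ce p - {{a, b}}) \<union> ce (a # ys @ [b])"
proof -
  obtain us vs where p: "p = us @ vs" "us \<noteq> []" "vs \<noteq> []" "{a, b} = {last us, hd vs}"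
    using ce_splitE[OF assms(2)] by metis
  define zs where "zs = (if a = last us then ys else rev ys)"
  have "last us \<in> set us" "hd vs \<in> set vs" "set us \<inter> set vs = {}"
    using p(1-3) assms(1) by simp_all
  then have notin: "{a, b} \<notin> ce us" "{a, b} \<notin> ce vs"
    using ce_subset_set[of "{a, b}" us] ce_subset_set[of "{a, b}" vs] unfolding p(4) by auto
  have zs: "zs \<noteq> []" "distinct zs" "set zs = set ys" "ce zs = ce ys"
    using assms by (auto simp: zs_def)
  have ay: "ce (a # ys @ [b]) = {{a, hd ys}} \<union> ce ys \<union> {{last ys, b}}"
    using assms(4) ce_append[of "[a]" "ys @ [b]"] by (auto simp: ce_append)
  have joints: "{{last us, hd zs}, {last zs, hd vs}} = {{a, hd ys}, {last ys, b}}"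
    using p(4) assms(4) by (auto simp: zs_def doubleton_eq_iff hd_rev last_rev)
  have "ce (us @ zs @ vs) = ce us \<union> ce vs \<union> (ce zs \<union> {{last us, hd zs}, {last zs, hd vs}})"
    using p(2,3) zs(1) by (auto simp: ce_append)
  also have "\<dots> = ce us \<union> ce vs \<union> ce (a # ys @ [b])"
    unfolding joints ay zs(4) by blast
  finally have "ce (us @ zs @ vs) = ce us \<union> ce vs \<union> ce (a # ys @ [b])" .
  moreover have "ce p - {{a, b}} = ce us \<union> ce vs"
    using ce_append[OF p(2,3)] notin unfolding p(1,4) by blast
  moreover have "distinct (us @ zs @ vs)" "set (us @ zs @ vs) = set p \<union> set ys"
    using assms(1,3,5) p(1) zs(2,3) by auto
  ultimately show ?thesis
    using that[of "us @ zs @ vs"] by simp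
qed

lemma fresh_list:
  fixes A :: "'a::infinite set"
  assumes "finite A"
  obtains xs where "length xs = n" "distinct xs" "set xs \<inter> A = {}"
proof -
  have "infinite (- A)"
    using assms by (simp add: Compl_eq_Diff_UNIV infinite_UNIV Diff_infinite_finite)
  then obtain B where B: "finite B" "card B = n" "B \<subseteq> - A"
    using infinite_arbitrarily_large by blast
  then obtain xs where "set xs = B" "distinct xs"
    using finite_distinct_list by blast
  then show ?thesis
    using that[of xs] B distinct_card[of xs] by auto
qed

section \<open>Tangles of paths and strands\<close>

text \<open>An edge lies in the symmetric difference of the paths iff it has an odd number of
  owners. Owners are indices and not paths, so a path can be changed in place without asking whether
  it then coincides with another one.\<close>

definition owners :: "nat \<Rightarrow> (nat \<Rightarrow> 'a list) \<Rightarrow> 'a set \<Rightarrow> nat set" where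
  "owners k P e = {i. i < k \<and> e \<in> ce (P i)}"

text \<open>\<open>V\<close> holds the vertices of the graph to be subdivided, \<open>P\<close> the
  covering paths, and strand \<open>r\<close> runs from \<open>s r\<close> through the new vertices
  \<open>X r\<close> to \<open>t r\<close>. The strands may form any multigraph on \<open>V\<close>,
  with loops and parallel strands. The last two conditions make tail swaps possible at any time:
  every strand has an inner edge with a single owner, and every path is the single owner of an inner
  edge of some strand. The edges are inner ones so that a cut leaves a nonempty piece on both
  sides.\<close>

locale tangle =
  fixes k :: nat and V :: "'a::infinite set" and I :: "nat set"
    and s t :: "nat \<Rightarrow> 'a" and X P :: "nat \<Rightarrow> 'a list"
  assumes finite_I: "finite I" and finite_V: "finite V"
    and distinct_P: "i < k \<Longrightarrow> distinct (P i)"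
    and set_P: "i < k \<Longrightarrow> set (P i) \<subseteq> V \<union> (\<Union>r\<in>I. set (X r))"
    and ends: "r \<in> I \<Longrightarrow> s r \<in> V \<and> t r \<in> V"
    and distinct_X: "r \<in> I \<Longrightarrow> distinct (X r)"
    and X_V: "r \<in> I \<Longrightarrow> set (X r) \<inter> V = {}"
    and X_X: "r \<in> I \<Longrightarrow> r' \<in> I \<Longrightarrow> r \<noteq> r' \<Longrightarrow> set (X r) \<inter> set (X r') = {}"
    and parity: "{e. odd (card (owners k P e))} = (\<Union>r\<in>I. ce (s r # X r @ [t r]))"
    and strand_owned: "r \<in> I \<Longrightarrow> \<exists>i. \<exists>e\<in>ce (X r). owners k P e = {i}"
    and path_owns: "i < k \<Longrightarrow> \<exists>r\<in>I. \<exists>e\<in>ce (X r). owners k P e = {i}"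
begin

definition support :: "'a set" where
  "support = V \<union> (\<Union>r\<in>I. set (X r))"

lemma finite_support: "finite support"
  using finite_I finite_V by (simp add: support_def)

lemma ce_P_support: "i < k \<Longrightarrow> e \<in> ce (P i) \<Longrightarrow> e \<subseteq> support"
  using ce_subset_set set_P unfolding support_def by blast

lemma owners_support: "owners k P e \<noteq> {} \<Longrightarrow> e \<subseteq> support"
  using ce_P_support unfolding owners_def by blast

lemma ownedD: "owners k P e = {i} \<Longrightarrow> i < k \<and> e \<in> ce (P i)"
  unfolding owners_def by blast

lemma set_X_support: "r \<in> I \<Longrightarrow> set (X r) \<subseteq> support"
  unfolding support_def by blast

text \<open>After the swap each of the two strands carries an edge of \<open>i\<close> and an edge
  of \<open>j\<close> at its new joint: \<open>ax\<close> and \<open>yb\<close> belong to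
  \<open>i\<close>, \<open>cy\<close> and \<open>xd\<close> to \<open>j\<close>. This renews the two
  ownership conditions for the strands and paths involved. The other strands keep their inner
  vertices and owners, which matters when swaps are chained.\<close>

lemma tail_swap:
  assumes r: "r \<in> I" "r' \<in> I" "r \<noteq> r'"
    and e: "e \<in> ce (X r)" "owners k P e = {i}"
    and f: "f \<in> ce (X r')" "owners k P f = {j}"
    and ij: "i \<noteq> j"
  obtains X' P' where
    "tangle k V I s (t(r := t r', r' := t r)) X' P'"
    "\<And>l c. l \<in> {r, r'} \<Longrightarrow> c \<in> {i, j} \<Longrightarrow> \<exists>g\<in>ce (X' l). owners k P' g = {c}"
    "\<And>l. l \<notin> {r, r'} \<Longrightarrow> X' l = X l"
    "\<And>l g. l \<in> I \<Longrightarrow> l \<notin> {r, r'} \<Longrightarrow> g \<in> ce (X l) \<Longrightarrow> owners k P' g = owners k P g"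
proof -
  obtain \<alpha> \<beta> where Xr: "X r = \<alpha> @ \<beta>" "\<alpha> \<noteq> []" "\<beta> \<noteq> []" "e = {last \<alpha>, hd \<beta>}"
    using ce_splitE[OF e(1)] by metis
  obtain \<gamma> \<delta> where Xr': "X r' = \<gamma> @ \<delta>" "\<gamma> \<noteq> []" "\<delta> \<noteq> []" "f = {last \<gamma>, hd \<delta>}"
    using ce_splitE[OF f(1)] by metis
  define a where "a = last \<alpha>"
  define b where "b = hd \<beta>"
  define c where "c = last \<gamma>"
  define d where "d = hd \<delta>"
  have ef: "e = {a, b}" "f = {c, d}"
    using Xr(4) Xr'(4) by (simp_all add: a_def b_def c_def d_def)
  \<comment> \<open>Two vertices outside the support, so that no edge at them belongs to any path
    yet.\<close>
  obtain zs where "length zs = 2" "distinct zs" "set zs \<inter> support = {}"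
    using fresh_list[OF finite_support] by metis
  then obtain x y where xy: "x \<noteq> y" "x \<notin> support" "y \<notin> support"
    by (auto simp: numeral_2_eq_2 length_Suc_conv)
  have mem: "a \<in> set \<alpha>" "b \<in> set \<beta>" "c \<in> set \<gamma>" "d \<in> set \<delta>"
    using Xr Xr' by (simp_all add: a_def b_def c_def d_def)
  have disj: "set \<alpha> \<inter> set \<beta> = {}" "set \<gamma> \<inter> set \<delta> = {}"
    "(set \<alpha> \<union> set \<beta>) \<inter> (set \<gamma> \<union> set \<delta>) = {}"
    using distinct_X[OF r(1)] distinct_X[OF r(2)] X_X[OF r] Xr(1) Xr'(1) by auto
  have supp: "set \<alpha> \<union> set \<beta> \<union> set \<gamma> \<union> set \<delta> \<subseteq> support"
    using set_X_support[OF r(1)] set_X_support[OF r(2)] Xr(1) Xr'(1) by auto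
  have dist: "a \<noteq> b" "a \<noteq> c" "a \<noteq> d" "b \<noteq> c" "b \<noteq> d" "c \<noteq> d"
    "a \<noteq> x" "a \<noteq> y" "b \<noteq> x" "b \<noteq> y" "c \<noteq> x" "c \<noteq> y" "d \<noteq> x" "d \<noteq> y" "x \<noteq> y"
    using mem disj supp xy by blast+
  have i: "i < k" "{a, b} \<in> ce (P i)" and j: "j < k" "{c, d} \<in> ce (P j)"
    using ownedD[OF e(2)] ownedD[OF f(2)] ef by auto
  have only: "n = i" if "n < k" "{a, b} \<in> ce (P n)" for n
    using e(2) that unfolding owners_def ef by blast
  have only': "n = j" if "n < k" "{c, d} \<in> ce (P n)" for n
    using f(2) that unfolding owners_def ef by blast
  have fresh: "x \<notin> g" "y \<notin> g" if "n < k" "g \<in> ce (P n)" for n g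
    using ce_P_support[OF that] xy by auto
  have PV: "set (P n) \<subseteq> support" if "n < k" for n
    using set_P[OF that] unfolding support_def .
  \<comment> \<open>The detours pass \<open>x\<close> and \<open>y\<close> in opposite orders. Both
    contain \<open>xy\<close>, which therefore gets two owners and drops out of the symmetric
    difference.\<close>
  obtain p where p: "distinct p" "set p = set (P i) \<union> set [x, y]"
    "ce p = (ce (P i) - {{a, b}}) \<union> ce (a # [x, y] @ [b])"
    by (rule splice_path[OF distinct_P[OF i(1)] i(2), of "[x, y]"]) (use xy PV[OF i(1)] in auto)
  obtain q where q: "distinct q" "set q = set (P j) \<union> set [y, x]"
    "ce q = (ce (P j) - {{c, d}}) \<union> ce (c # [y, x] @ [d])"
    by (rule splice_path[OF distinct_P[OF j(1)] j(2), of "[y, x]"]) (use xy PV[OF j(1)] in auto)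
  define P' where "P' = P(i := p, j := q)"
  \<comment> \<open>The heads keep their strand indices and the tails change places, with
    \<open>x\<close> and \<open>y\<close> at the joints.\<close>
  define X' where "X' = X(r := \<alpha> @ [x] @ \<delta>, r' := \<gamma> @ [y] @ \<beta>)"
  define t' where "t' = t(r := t r', r' := t r)"
  have ceP': "g \<in> ce (P' n) \<longleftrightarrow>
      (if n = i then g \<in> ce (P i) \<and> g \<noteq> {a, b} \<or> g = {a, x} \<or> g = {x, y} \<or> g = {y, b}
       else if n = j then g \<in> ce (P j) \<and> g \<noteq> {c, d} \<or> g = {c, y} \<or> g = {x, y} \<or> g = {x, d}
       else g \<in> ce (P n))" for g n
    using p(3) q(3) ij by (auto simp: P'_def insert_commute)
  have no: "{u, x} \<notin> ce (P n)" "{u, y} \<notin> ce (P n)" "{x, u} \<notin> ce (P n)" "{y, u} \<notin> ce (P n)"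
    if "n < k" for n u
    using fresh[OF that] by blast+
  have own_ax: "owners k P' {a, x} = {i}" and own_yb: "owners k P' {y, b} = {i}"
    and own_cy: "owners k P' {c, y} = {j}" and own_xd: "owners k P' {x, d} = {j}"
    using no dist ij i j unfolding owners_def ceP' by (auto simp: doubleton_eq_iff)
  have own_xy: "owners k P' {x, y} = {i, j}"
    using no dist ij i j unfolding owners_def ceP' by (auto simp: doubleton_eq_iff)
  have own_ab: "owners k P' {a, b} = {}" and own_cd: "owners k P' {c, d} = {}"
    using only only' dist ij unfolding owners_def ceP' by (auto simp: doubleton_eq_iff)
  \<comment> \<open>The new edges with a single owner; \<open>xy\<close> is missing because it has
    two.\<close>
  define N where "N = {{a, x}, {x, d}, {c, y}, {y, b}}"
  have own: "owners k P' g = owners k P g"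
    if "g \<noteq> {a, b}" "g \<noteq> {c, d}" "g \<noteq> {x, y}" "g \<notin> N" for g
  proof -
    have "g \<in> ce (P' n) \<longleftrightarrow> g \<in> ce (P n)" for n
      using that by (simp add: ceP' N_def)
    then show ?thesis by (simp add: owners_def)
  qed
  have own_old: "owners k P' g = owners k P g"
    if "g \<noteq> {a, b}" "g \<noteq> {c, d}" "g \<subseteq> support" for g
    by (rule own) (use that xy in \<open>auto simp: N_def\<close>)
  have own_xy_old: "owners k P {x, y} = {}"
    using owners_support[of "{x, y}"] xy by blast
  have parity': "{g. odd (card (owners k P' g))} = {g. odd (card (owners k P g))} - {{a, b}, {c, d}} \<union> N"
  proof (intro set_eqI)
    fix g
    consider "g = {a, b}" | "g = {c, d}" | "g = {x, y}" | "g \<in> N"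
      | "g \<noteq> {a, b}" "g \<noteq> {c, d}" "g \<noteq> {x, y}" "g \<notin> N" by blast
    then show "g \<in> {g. odd (card (owners k P' g))} \<longleftrightarrow>
        g \<in> {g. odd (card (owners k P g))} - {{a, b}, {c, d}} \<union> N"
    proof cases
      case 1
      then have "g \<notin> N" using dist by (auto simp: N_def doubleton_eq_iff)
      then show ?thesis using own_ab 1 by simp
    next
      case 2
      then have "g \<notin> N" using dist by (auto simp: N_def doubleton_eq_iff)
      then show ?thesis using own_cd 2 by simp
    next
      case 3
      then have "g \<notin> N" using dist by (auto simp: N_def doubleton_eq_iff)
      then show ?thesis using own_xy own_xy_old 3 ij by simp
    next
      case 4
      then have "card (owners k P' g) = 1"
        using own_ax own_yb own_cy own_xd by (auto simp: N_def)
      then show ?thesis using 4 by simp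
    next
      case 5
      then show ?thesis using own by simp
    qed
  qed
  \<comment> \<open>\<open>Rest\<close> and \<open>A\<close> collect the strand edges untouched by
    the swap, so that the old and the new union differ only in the two cut edges and
    \<open>N\<close>.\<close>
  define Rest where "Rest = (\<Union>l\<in>I - {r, r'}. ce (s l # X l @ [t l]))"
  define A where "A = ce (s r # \<alpha>) \<union> ce (\<beta> @ [t r]) \<union> ce (s r' # \<gamma>) \<union> ce (\<delta> @ [t r'])"
  have I_split: "(\<Union>l\<in>I. F l) = F r \<union> F r' \<union> (\<Union>l\<in>I - {r, r'}. F l)" for F :: "nat \<Rightarrow> 'a set set"
    using r by blast
  have old_r: "ce (s r # X r @ [t r]) = ce (s r # \<alpha>) \<union> {{a, b}} \<union> ce (\<beta> @ [t r])"
    using ce_append[of "s r # \<alpha>" "\<beta> @ [t r]"] Xr(1-3) by (simp add: a_def b_def)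
  have old_r': "ce (s r' # X r' @ [t r']) = ce (s r' # \<gamma>) \<union> {{c, d}} \<union> ce (\<delta> @ [t r'])"
    using ce_append[of "s r' # \<gamma>" "\<delta> @ [t r']"] Xr'(1-3) by (simp add: c_def d_def)
  have old: "(\<Union>l\<in>I. ce (s l # X l @ [t l])) = A \<union> Rest \<union> {{a, b}, {c, d}}"
    unfolding I_split[of "\<lambda>l. ce (s l # X l @ [t l])"] old_r old_r' A_def Rest_def by blast
  have X'r: "X' r = \<alpha> @ [x] @ \<delta>" "X' r' = \<gamma> @ [y] @ \<beta>" "t' r = t r'" "t' r' = t r"
    using r(3) by (simp_all add: X'_def t'_def)
  have X'_other: "X' l = X l" "t' l = t l" if "l \<notin> {r, r'}" for l
    using that by (simp_all add: X'_def t'_def)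
  have new_r: "ce (s r # X' r @ [t' r]) = ce (s r # \<alpha>) \<union> {{a, x}, {x, d}} \<union> ce (\<delta> @ [t r'])"
    using ce_append_single[of "s r # \<alpha>" "\<delta> @ [t r']" x] Xr(2) Xr'(3)
    unfolding X'r by (simp add: a_def d_def)
  have new_r': "ce (s r' # X' r' @ [t' r']) = ce (s r' # \<gamma>) \<union> {{c, y}, {y, b}} \<union> ce (\<beta> @ [t r])"
    using ce_append_single[of "s r' # \<gamma>" "\<beta> @ [t r]" y] Xr(3) Xr'(2)
    unfolding X'r by (simp add: c_def b_def)
  have new_rest: "(\<Union>l\<in>I - {r, r'}. ce (s l # X' l @ [t' l])) = Rest"
    unfolding Rest_def using X'_other by auto
  have new: "(\<Union>l\<in>I. ce (s l # X' l @ [t' l])) = A \<union> Rest \<union> N"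
    unfolding I_split[of "\<lambda>l. ce (s l # X' l @ [t' l])"] new_r new_r' new_rest A_def N_def by blast
  have V: "s l \<in> V" "t l \<in> V" "set (X l) \<inter> V = {}" if "l \<in> I" for l
    using ends X_V that by auto
  have abV: "a \<notin> V" "b \<notin> V" "c \<notin> V" "d \<notin> V"
    using V(3)[OF r(1)] V(3)[OF r(2)] mem Xr(1) Xr'(1) by auto
  \<comment> \<open>The symmetric difference loses \<open>ab\<close> and \<open>cd\<close>, so
    neither may occur a second time among the remaining strand edges. An inner vertex lies on one
    strand only, and only once.\<close>
  have notA: "{a, b} \<notin> A" "{c, d} \<notin> A"
  proof -
    have "b \<notin> set (s r # \<alpha>)" "a \<notin> set (\<beta> @ [t r])" "a \<notin> set (s r' # \<gamma>)" "a \<notin> set (\<delta> @ [t r'])"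
      "c \<notin> set (s r # \<alpha>)" "c \<notin> set (\<beta> @ [t r])" "d \<notin> set (s r' # \<gamma>)" "c \<notin> set (\<delta> @ [t r'])"
      using abV V(1,2)[OF r(1)] V(1,2)[OF r(2)] mem disj by auto
    then show "{a, b} \<notin> A" "{c, d} \<notin> A"
      unfolding A_def by (auto dest: ce_subset_set)
  qed
  have notRest: "{a, b} \<notin> Rest" "{c, d} \<notin> Rest"
  proof -
    have "a \<notin> set (s l # X l @ [t l])" "c \<notin> set (s l # X l @ [t l])" if "l \<in> I - {r, r'}" for l
      using abV V(1,2)[of l] X_X[of l r] X_X[of l r'] mem Xr(1) Xr'(1) that r by auto
    then show "{a, b} \<notin> Rest" "{c, d} \<notin> Rest"
      unfolding Rest_def by (auto dest!: ce_subset_set)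
  qed
  have X'_subset: "set (X' r) = set \<alpha> \<union> {x} \<union> set \<delta>" "set (X' r') = set \<gamma> \<union> {y} \<union> set \<beta>"
    unfolding X'r by auto
  have support': "V \<union> (\<Union>l\<in>I. set (X' l)) = support \<union> {x, y}"
  proof -
    have split: "(\<Union>l\<in>I. F l) = F r \<union> F r' \<union> (\<Union>l\<in>I - {r, r'}. F l)" for F :: "nat \<Rightarrow> 'a set"
      using r by blast
    have rest: "(\<Union>l\<in>I - {r, r'}. set (X' l)) = (\<Union>l\<in>I - {r, r'}. set (X l))"
      using X'_other by auto
    show ?thesis
      unfolding support_def split[of "\<lambda>l. set (X' l)"] split[of "\<lambda>l. set (X l)"] rest
        X'_subset Xr(1) Xr'(1) set_append by blast
  qed
  have own_X: "owners k P' g = owners k P g" if "l \<in> I" "g \<in> ce (X l)" "g \<noteq> {a, b}" "g \<noteq> {c, d}" for l g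
    using own_old that ce_subset_set[OF that(2)] set_X_support[OF that(1)] by blast
  have not_ab: "g \<noteq> {a, b}" "g \<noteq> {c, d}" if "l \<in> I" "l \<notin> {r, r'}" "g \<in> ce (X l)" for l g
    using ce_subset_set[OF that(3)] X_X[of l r] X_X[of l r'] mem Xr(1) Xr'(1) that r by auto
  have ceX': "ce (X' r) = ce \<alpha> \<union> {{a, x}, {x, d}} \<union> ce \<delta>" "ce (X' r') = ce \<gamma> \<union> {{c, y}, {y, b}} \<union> ce \<beta>"
    unfolding X'r using ce_append_single[of \<alpha> \<delta> x] ce_append_single[of \<gamma> \<beta> y] Xr(2,3) Xr'(2,3)
    by (simp_all add: a_def b_def c_def d_def)
  have ceX: "ce (X r) = ce \<alpha> \<union> {{a, b}} \<union> ce \<beta>" "ce (X r') = ce \<gamma> \<union> {{c, d}} \<union> ce \<delta>"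
    unfolding Xr(1) Xr'(1) using ce_append[of \<alpha> \<beta>] ce_append[of \<gamma> \<delta>] Xr(2,3) Xr'(2,3)
    by (simp_all add: a_def b_def c_def d_def)
  have owned': "\<exists>g\<in>ce (X' l). owners k P' g = {m}" if "l \<in> {r, r'}" "m \<in> {i, j}" for l m
    using that ceX' own_ax own_yb own_cy own_xd by blast
  have "tangle k V I s t' X' P'"
  proof
    show "finite I" "finite V" by (fact finite_I finite_V)+
    show "distinct (P' n)" if "n < k" for n
      using distinct_P[OF that] p(1) q(1) by (simp add: P'_def)
    show "set (P' n) \<subseteq> V \<union> (\<Union>l\<in>I. set (X' l))" if "n < k" for n
      unfolding support' using PV[OF that] PV[OF i(1)] PV[OF j(1)] p(2) q(2) by (auto simp: P'_def)
    show "s l \<in> V \<and> t' l \<in> V" if "l \<in> I" for l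
      using ends that r by (auto simp: t'_def)
    show "distinct (X' l)" if "l \<in> I" for l
    proof -
      have "x \<notin> set \<alpha> \<union> set \<delta>" "y \<notin> set \<gamma> \<union> set \<beta>" "set \<alpha> \<inter> set \<delta> = {}" "set \<gamma> \<inter> set \<beta> = {}"
        using supp xy disj by blast+
      then show ?thesis
        using distinct_X[OF that] distinct_X[OF r(1)] distinct_X[OF r(2)] Xr(1) Xr'(1)
        by (auto simp: X'_def)
    qed
    have V_supp: "V \<subseteq> support" by (auto simp: support_def)
    show "set (X' l) \<inter> V = {}" if "l \<in> I" for l
    proof -
      have rr: "set (X' r) \<inter> V = {}" "set (X' r') \<inter> V = {}"
        using V(3)[OF r(1)] V(3)[OF r(2)] V_supp xy unfolding X'_subset Xr(1) Xr'(1) by auto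
      show ?thesis
      proof (cases "l \<in> {r, r'}")
        case True
        then show ?thesis using rr by blast
      next
        case False
        then show ?thesis using V(3)[OF that] by (simp add: X'_other(1)[OF False])
      qed
    qed
    show "set (X' l) \<inter> set (X' l') = {}" if "l \<in> I" "l' \<in> I" "l \<noteq> l'" for l l'
    proof -
      have 1: "set (X' r) \<inter> set (X' r') = {}"
        using disj supp xy unfolding X'_subset by blast
      have 2: "set (X' r) \<inter> set (X' m) = {}" "set (X' r') \<inter> set (X' m) = {}"
        if m: "m \<in> I" "m \<notin> {r, r'}" for m
      proof -
        have "set (X r) \<inter> set (X m) = {}" "set (X r') \<inter> set (X m) = {}"
          using X_X[of r m] X_X[of r' m] m r by auto
        then show "set (X' r) \<inter> set (X' m) = {}" "set (X' r') \<inter> set (X' m) = {}"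
          using set_X_support[OF m(1)] xy
          unfolding X'_subset X'_other(1)[OF m(2)] Xr(1) Xr'(1) by auto
      qed
      consider "l = r" "l' = r'" | "l = r'" "l' = r" | "l \<in> {r, r'}" "l' \<notin> {r, r'}"
        | "l \<notin> {r, r'}" "l' \<in> {r, r'}" | "l \<notin> {r, r'}" "l' \<notin> {r, r'}"
        using \<open>l \<noteq> l'\<close> by blast
      then show ?thesis
      proof cases
        case 3
        then show ?thesis using 2[OF that(2)] by auto
      next
        case 4
        then show ?thesis using 2[OF that(1)] by auto
      next
        case 5
        then show ?thesis using X_X[OF that] X'_other(1) by simp
      qed (use 1 in auto)
    qed
    show "{g. odd (card (owners k P' g))} = (\<Union>l\<in>I. ce (s l # X' l @ [t' l]))"
      unfolding parity' parity new old using notA notRest by blast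
    show "\<exists>m. \<exists>g\<in>ce (X' l). owners k P' g = {m}" if "l \<in> I" for l
    proof (cases "l \<in> {r, r'}")
      case True
      then show ?thesis using owned' by blast
    next
      case False
      then show ?thesis
        using strand_owned[OF that] own_X[OF that] not_ab[OF that] X'_other[of l] by metis
    qed
    show "\<exists>l\<in>I. \<exists>g\<in>ce (X' l). owners k P' g = {m}" if m: "m < k" for m
    proof (cases "m \<in> {i, j}")
      case True
      then show ?thesis using owned'[of r m] r by blast
    next
      case False
      obtain l g where g: "l \<in> I" "g \<in> ce (X l)" "owners k P g = {m}"
        using path_owns[OF m] by blast
      then have "g \<noteq> {a, b}" "g \<noteq> {c, d}" using False e(2) f(2) ef by auto
      then have "owners k P' g = {m}" using own_X g by blast
      \<comment> \<open>Except for the two cut edges, every inner edge of the old strands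
        \<open>r\<close> and \<open>r'\<close> survives in one of the new ones.\<close>
      moreover have "\<exists>l'\<in>I. g \<in> ce (X' l')"
      proof (cases "l \<in> {r, r'}")
        case True
        then have "g \<in> ce (X' r) \<union> ce (X' r')"
          using g(2) \<open>g \<noteq> {a, b}\<close> \<open>g \<noteq> {c, d}\<close> unfolding ceX' using ceX by blast
        then show ?thesis using r by blast
      next
        case False
        then show ?thesis using g X'_other by metis
      qed
      ultimately show ?thesis by blast
    qed
  qed
  then show ?thesis
  proof (rule that[of X' P', folded t'_def])
    show "\<exists>g\<in>ce (X' l). owners k P' g = {m}" if "l \<in> {r, r'}" "m \<in> {i, j}" for l m
      using that by (rule owned')
    show "X' l = X l" if "l \<notin> {r, r'}" for l
      using that by (rule X'_other)
    show "owners k P' g = owners k P g" if "l \<in> I" "l \<notin> {r, r'}" "g \<in> ce (X l)" for l g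
      using that(1,3) not_ab[OF that] by (rule own_X)
  qed
qed

end

section \<open>Rearranging the strand ends\<close>

text \<open>Only the strand ends are kept, as the inner vertices and the paths change with every
  move.\<close>

definition realizable :: "nat \<Rightarrow> 'a::infinite set \<Rightarrow> nat set \<Rightarrow> (nat \<Rightarrow> 'a) \<Rightarrow> (nat \<Rightarrow> 'a) \<Rightarrow> bool" where
  "realizable k V I s t \<longleftrightarrow> (\<exists>X P. tangle k V I s t X P)"

text \<open>A tail swap needs edges with different owners on the two strands. If the known edges
  have the same owner, a second path \<open>m\<close> supplies another edge: directly if it lies on
  \<open>r\<close> or \<open>r'\<close>, and otherwise after it has been carried to \<open>r\<close>
  by way of a third strand.\<close>

lemma realizable_swap:
  assumes "realizable k V I s t" and k: "2 \<le> k" and r: "r \<in> I" "r' \<in> I"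
  shows "realizable k V I s (t(r := t r', r' := t r))"
proof (cases "r = r'")
  case True
  then show ?thesis using assms by simp
next
  case False
  obtain X P where T: "tangle k V I s t X P"
    using assms(1) unfolding realizable_def by blast
  have direct: "realizable k V I s (t(r := t r', r' := t r))"
    if T: "tangle k V I s t X P" and e: "e \<in> ce (X r)" "owners k P e = {i}"
      and f: "f \<in> ce (X r')" "owners k P f = {j}" and ij: "i \<noteq> j" for X P e f i j
    by (rule tangle.tail_swap[OF T r False e f ij]) (auto simp: realizable_def)
  obtain i e where e: "e \<in> ce (X r)" "owners k P e = {i}"
    using tangle.strand_owned[OF T r(1)] by blast
  obtain j f where f: "f \<in> ce (X r')" "owners k P f = {j}"
    using tangle.strand_owned[OF T r(2)] by blast
  show ?thesis
  proof (cases "i = j")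
    case False
    then show ?thesis using direct[OF T e f] by blast
  next
    case ij: True
    \<comment> \<open>A second path exists because \<open>2 \<le> k\<close>.\<close>
    obtain m where m: "m < k" "m \<noteq> i"
      using k by (metis less_le_trans one_less_numeral_iff pos2 semiring_norm(76) zero_neq_one)
    obtain q g where q: "q \<in> I" and g: "g \<in> ce (X q)" "owners k P g = {m}"
      using tangle.path_owns[OF T m(1)] by blast
    consider "q = r" | "q = r'" | "q \<noteq> r" "q \<noteq> r'" by blast
    then show ?thesis
    proof cases
      case 1
      then show ?thesis using direct[OF T _ _ f, of g m] g m(2) ij by blast
    next
      case 2
      then show ?thesis using direct[OF T e, of g m] g m(2) by blast
    next
      case 3
      \<comment> \<open>Swapping the tails of \<open>r\<close> and \<open>q\<close> twice restores the ends, but leaves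
        \<open>r\<close> with an edge owned by \<open>m\<close>.\<close>
      have rq: "r \<noteq> q" using 3 by blast
      obtain X1 P1 where T1: "tangle k V I s (t(r := t q, q := t r)) X1 P1"
        and own1: "\<And>l c. l \<in> {r, q} \<Longrightarrow> c \<in> {i, m} \<Longrightarrow> \<exists>g\<in>ce (X1 l). owners k P1 g = {c}"
        and X1: "\<And>l. l \<notin> {r, q} \<Longrightarrow> X1 l = X l"
        and P1: "\<And>l g. l \<in> I \<Longrightarrow> l \<notin> {r, q} \<Longrightarrow> g \<in> ce (X l) \<Longrightarrow> owners k P1 g = owners k P g"
        by (rule tangle.tail_swap[OF T r(1) q rq e g]) (use m(2) in auto)
      obtain e1 where e1: "e1 \<in> ce (X1 r)" "owners k P1 e1 = {i}"
        using own1[of r i] by auto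
      obtain g1 where g1: "g1 \<in> ce (X1 q)" "owners k P1 g1 = {m}"
        using own1[of q m] by auto
      obtain X2 P2 where T2: "tangle k V I s ((t(r := t q, q := t r))
            (r := (t(r := t q, q := t r)) q, q := (t(r := t q, q := t r)) r)) X2 P2"
        and own2: "\<And>l c. l \<in> {r, q} \<Longrightarrow> c \<in> {i, m} \<Longrightarrow> \<exists>g\<in>ce (X2 l). owners k P2 g = {c}"
        and X2: "\<And>l. l \<notin> {r, q} \<Longrightarrow> X2 l = X1 l"
        and P2: "\<And>l g. l \<in> I \<Longrightarrow> l \<notin> {r, q} \<Longrightarrow> g \<in> ce (X1 l) \<Longrightarrow> owners k P2 g = owners k P1 g"
        by (rule tangle.tail_swap[OF T1 r(1) q rq e1 g1]) (use m(2) in auto)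
      have "(t(r := t q, q := t r))
            (r := (t(r := t q, q := t r)) q, q := (t(r := t q, q := t r)) r) = t"
        using rq by auto
      then have T2': "tangle k V I s t X2 P2" using T2 by simp
      obtain e2 where e2: "e2 \<in> ce (X2 r)" "owners k P2 e2 = {m}"
        using own2[of r m] by auto
      \<comment> \<open>Both swaps leave the strand \<open>r'\<close> alone, so \<open>f\<close> is
        still an edge of it with the single owner \<open>j\<close>.\<close>
      have r': "r' \<notin> {r, q}" using 3 False by blast
      have "f \<in> ce (X2 r')" "owners k P2 f = {j}"
        using f P1[OF r(2) r'] P2[OF r(2) r'] X1[OF r'] X2[OF r'] by simp_all
      then show ?thesis
        using direct[OF T2' e2] m(2) ij by blast
    qed
  qed
qed

text \<open>Reading a strand backwards changes no edge. Swaps exchange only targets, so flips are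
  needed to bring any given end into the target position.\<close>

lemma realizable_flip:
  assumes "realizable k V I s t" and r: "r \<in> I"
  shows "realizable k V I (s(r := t r)) (t(r := s r))"
proof -
  obtain X P where T: "tangle k V I s t X P"
    using assms(1) unfolding realizable_def by blast
  interpret tangle k V I s t X P by (rule T)
  define s' t' X' where "s' = s(r := t r)" and "t' = t(r := s r)" and "X' = X(r := rev (X r))"
  have X': "set (X' l) = set (X l)" "ce (X' l) = ce (X l)" "distinct (X' l) = distinct (X l)" for l
    by (simp_all add: X'_def)
  have strand: "ce (s' l # X' l @ [t' l]) = ce (s l # X l @ [t l])" for l
    using ce_rev[of "s l # X l @ [t l]"] by (auto simp: s'_def t'_def X'_def)
  have ends': "s' l \<in> V \<and> t' l \<in> V" if "l \<in> I" for l
    using ends[OF that] ends[OF r] by (simp add: s'_def t'_def)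
  have "tangle k V I s' t' X' P"
    by unfold_locales
      (use finite_I finite_V distinct_P set_P ends' distinct_X X_V X_X parity strand_owned path_owns in
        \<open>simp_all add: X' strand\<close>)
  then show ?thesis unfolding realizable_def s'_def t'_def by blast
qed

text \<open>The degree of \<open>v\<close> in the multigraph formed by the strands of
  \<open>U\<close>; a strand with both ends at \<open>v\<close> counts twice.\<close>

definition end_degree :: "nat set \<Rightarrow> (nat \<Rightarrow> 'a) \<Rightarrow> (nat \<Rightarrow> 'a) \<Rightarrow> 'a \<Rightarrow> nat" where
  "end_degree U s t v = (\<Sum>r\<in>U. of_bool (s r = v) + of_bool (t r = v))"

lemma end_degree_remove:
  "finite U \<Longrightarrow> r \<in> U \<Longrightarrow>
    end_degree U s t v = of_bool (s r = v) + of_bool (t r = v) + end_degree (U - {r}) s t v"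
  unfolding end_degree_def by (simp add: sum.remove)

lemma end_degree_cong:
  "(\<And>r. r \<in> U \<Longrightarrow> s r = s' r \<and> t r = t' r) \<Longrightarrow> end_degree U s t v = end_degree U s' t' v"
  unfolding end_degree_def by (intro sum.cong) auto

lemma end_degree_flip:
  assumes "finite U" "r \<in> U"
  shows "end_degree U (s(r := t r)) (t(r := s r)) v = end_degree U s t v"
  using end_degree_cong[of "U - {r}" "s(r := t r)" s "t(r := s r)" t v]
  by (simp add: end_degree_remove[OF assms])

lemma end_degree_swap:
  assumes "finite U" "r \<in> U" "r' \<in> U"
  shows "end_degree U s (t(r := t r', r' := t r)) v = end_degree U s t v"
proof (cases "r = r'")
  case False
  have 1: "finite (U - {r})" "r' \<in> U - {r}" using assms False by auto
  show ?thesis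
    using False end_degree_cong[of "U - {r} - {r'}" s s "t(r := t r', r' := t r)" t v]
    by (simp add: end_degree_remove[OF assms(1,2)] end_degree_remove[OF 1])
qed simp

lemma end_degree_pos:
  "finite U \<Longrightarrow> 0 < end_degree U s t v \<Longrightarrow> \<exists>r\<in>U. s r = v \<or> t r = v"
  unfolding end_degree_def by (rule ccontr) simp

text \<open>Flip a strand at \<open>u\<close> so that it starts there, flip a strand at
  \<open>v\<close> so that it ends there, and swap their targets. All moves stay within
  \<open>U\<close>, so strands that already have the right ends are not disturbed.\<close>

lemma realizable_join:
  assumes R: "realizable k V I s t" and k: "2 \<le> k" and U: "finite U" "U \<subseteq> I" and uv: "u \<noteq> v"
    and deg: "0 < end_degree U s t u" "0 < end_degree U s t v"
  obtains s' t' r where "realizable k V I s' t'" "\<And>l. l \<notin> U \<Longrightarrow> s' l = s l \<and> t' l = t l"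
    "\<And>w. end_degree U s' t' w = end_degree U s t w" "r \<in> U" "s' r = u" "t' r = v"
proof -
  obtain r where r: "r \<in> U" "s r = u \<or> t r = u"
    using end_degree_pos[OF U(1) deg(1)] by blast
  have rI: "r \<in> I" using r U by blast
  have "\<exists>s1 t1. realizable k V I s1 t1 \<and> (\<forall>l. l \<notin> U \<longrightarrow> s1 l = s l \<and> t1 l = t l) \<and>
      (\<forall>w. end_degree U s1 t1 w = end_degree U s t w) \<and> s1 r = u"
  proof (cases "s r = u")
    case False
    then show ?thesis
      using r U realizable_flip[OF R rI] end_degree_flip[OF U(1) r(1)]
      by (intro exI[of _ "s(r := t r)"] exI[of _ "t(r := s r)"]) auto
  qed (use R in blast)
  then obtain s1 t1 where 1: "realizable k V I s1 t1" "\<And>l. l \<notin> U \<Longrightarrow> s1 l = s l \<and> t1 l = t l"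
    "\<And>w. end_degree U s1 t1 w = end_degree U s t w" "s1 r = u" by blast
  obtain q where q: "q \<in> U" "s1 q = v \<or> t1 q = v"
    using end_degree_pos[OF U(1), of s1 t1 v] deg(2) 1(3) by auto
  have qI: "q \<in> I" using q U by blast
  show ?thesis
  proof (cases "q = r")
    \<comment> \<open>The strand starts at \<open>u\<close>, which differs from \<open>v\<close>, so
      \<open>v\<close> is its target and nothing is left to do.\<close>
    case True
    then show ?thesis using that[of s1 t1 r] 1 q uv by auto
  next
    case False
    have "\<exists>s2 t2. realizable k V I s2 t2 \<and> (\<forall>l. l \<notin> U \<longrightarrow> s2 l = s l \<and> t2 l = t l) \<and>
        (\<forall>w. end_degree U s2 t2 w = end_degree U s t w) \<and> s2 r = u \<and> t2 q = v"
    proof (cases "t1 q = v")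
      case nt: False
      show ?thesis
      proof (intro exI conjI)
        show "realizable k V I (s1(q := t1 q)) (t1(q := s1 q))"
          by (rule realizable_flip[OF 1(1) qI])
        show "\<forall>w. end_degree U (s1(q := t1 q)) (t1(q := s1 q)) w = end_degree U s t w"
          using end_degree_flip[OF U(1) q(1)] 1(3) by metis
      qed (use q 1(2,4) False nt in auto)
    qed (use 1 in blast)
    then obtain s2 t2 where 2: "realizable k V I s2 t2" "\<And>l. l \<notin> U \<Longrightarrow> s2 l = s l \<and> t2 l = t l"
      "\<And>w. end_degree U s2 t2 w = end_degree U s t w" "s2 r = u" "t2 q = v" by blast
    show ?thesis
    proof (rule that)
      show "realizable k V I s2 (t2(r := t2 q, q := t2 r))"
        by (rule realizable_swap[OF 2(1) k rI qI])
      show "end_degree U s2 (t2(r := t2 q, q := t2 r)) w = end_degree U s t w" for w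
        using end_degree_swap[OF U(1) r(1) q(1)] 2(3) by metis
    qed (use 2 r q False in auto)
  qed
qed

text \<open>Induction over the edges still to be realized. \<open>F\<close> holds the finished
  strands and \<open>U\<close> the free ones, whose end degrees agree with the degrees in the
  remaining edge set. For an edge \<open>uv\<close> a free strand is given the ends \<open>u\<close>
  and \<open>v\<close> and is moved to \<open>F\<close>.\<close>

lemma realizable_matching:
  assumes "finite E" "\<And>e. e \<in> E \<Longrightarrow> e \<subseteq> V \<and> card e = 2" "2 \<le> k"
    and "realizable k V (F \<union> U) s t" "F \<inter> U = {}"
    and "\<And>v. v \<in> V \<Longrightarrow> end_degree U s t v = card {e \<in> E. v \<in> e}"
  shows "\<exists>s' t'. realizable k V (F \<union> U) s' t' \<and> (\<forall>r\<in>F. s' r = s r \<and> t' r = t r) \<and>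
    bij_betw (\<lambda>r. {s' r, t' r}) U E"
  using assms
proof (induction E arbitrary: F U s t rule: finite_induct)
  case empty
  obtain X P where "tangle k V (F \<union> U) s t X P"
    using empty(3) unfolding realizable_def by blast
  then interpret tangle k V "F \<union> U" s t X P .
  \<comment> \<open>With no edges left all end degrees on \<open>V\<close> vanish, whereas a free
    strand would add to the one at its start.\<close>
  have "U = {}"
  proof (rule ccontr)
    assume "U \<noteq> {}"
    then obtain r where r: "r \<in> U" by blast
    have "finite U" using finite_I by simp
    then have "end_degree U s t (s r) \<noteq> 0"
      using end_degree_remove[OF _ r, of s t "s r"] by simp
    then show False using empty(5)[of "s r"] ends[of r] r by simp
  qed
  then have "realizable k V (F \<union> U) s t \<and> (\<forall>r\<in>F. s r = s r \<and> t r = t r) \<and>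
      bij_betw (\<lambda>r. {s r, t r}) U {}"
    using empty(3) by (simp add: bij_betw_def)
  then show ?case by blast
next
  case (insert e E)
  obtain X P where "tangle k V (F \<union> U) s t X P"
    using insert.prems(3) unfolding realizable_def by blast
  then have "finite (F \<union> U)" using tangle.finite_I by blast
  then have fin: "finite U" by simp
  obtain u v where e: "e = {u, v}" "u \<noteq> v"
    using insert.prems(1)[of e] by (auto simp: card_2_iff)
  have V: "u \<in> V" "v \<in> V" using insert.prems(1)[of e] e by auto
  have card: "card {g \<in> insert e E. w \<in> g} = of_bool (w \<in> e) + card {g \<in> E. w \<in> g}" for w
  proof -
    have "{g \<in> insert e E. w \<in> g} = (if w \<in> e then insert e {g \<in> E. w \<in> g} else {g \<in> E. w \<in> g})"
      by auto
    then show ?thesis using insert.hyps by auto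
  qed
  obtain s1 t1 r where 1: "realizable k V (F \<union> U) s1 t1" "\<And>l. l \<notin> U \<Longrightarrow> s1 l = s l \<and> t1 l = t l"
    "\<And>w. end_degree U s1 t1 w = end_degree U s t w" "r \<in> U" "s1 r = u" "t1 r = v"
    by (rule realizable_join[OF insert.prems(3,2) fin _ e(2)])
      (use insert.prems(5) V card e in auto)
  have FU: "insert r F \<union> (U - {r}) = F \<union> U" using 1(4) by auto
  have "\<exists>s' t'. realizable k V (insert r F \<union> (U - {r})) s' t' \<and>
      (\<forall>l\<in>insert r F. s' l = s1 l \<and> t' l = t1 l) \<and> bij_betw (\<lambda>l. {s' l, t' l}) (U - {r}) E"
  proof (rule insert.IH)
    show "realizable k V (insert r F \<union> (U - {r})) s1 t1" unfolding FU by (rule 1(1))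
    \<comment> \<open>Removing strand \<open>r\<close> and removing edge \<open>e\<close> both lower
      the count by one at \<open>u\<close> and at \<open>v\<close>, and nowhere else.\<close>
    show "end_degree (U - {r}) s1 t1 w = card {g \<in> E. w \<in> g}" if "w \<in> V" for w
    proof -
      have "of_bool (w \<in> e) = of_bool (u = w) + (of_bool (v = w) :: nat)" using e by auto
      moreover have "end_degree U s1 t1 w = card {g \<in> insert e E. w \<in> g}"
        using 1(3) insert.prems(5)[OF that] by metis
      ultimately show ?thesis
        using end_degree_remove[OF fin 1(4), of s1 t1 w] card[of w] unfolding 1(5,6) by linarith
    qed
  qed (use insert.prems in auto)
  then obtain s' t' where 2: "realizable k V (F \<union> U) s' t'"
    "\<And>l. l \<in> insert r F \<Longrightarrow> s' l = s1 l \<and> t' l = t1 l" "bij_betw (\<lambda>l. {s' l, t' l}) (U - {r}) E"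
    unfolding FU by blast
  have "{s' r, t' r} = e" using 2(2)[of r] 1(5,6) e by simp
  then have "bij_betw (\<lambda>l. {s' l, t' l}) (insert r (U - {r})) (insert e E)"
    using notIn_Un_bij_betw[of r "U - {r}" "\<lambda>l. {s' l, t' l}" E] 2(3) insert.hyps(2) by simp
  moreover have "insert r (U - {r}) = U" using 1(4) by blast
  moreover have "\<forall>l\<in>F. s' l = s l \<and> t' l = t l"
    using 1(2) 2(2) insert.prems(4) by auto
  ultimately show ?case using 2(1) by auto
qed

section \<open>Additional visits of paths to vertices, and the initial tangle\<close>

text \<open>Path \<open>i\<close> is rerouted from \<open>ab\<close>, an edge that it alone owns, to
  \<open>axvyb\<close>. This cuts strand \<open>r\<close> at \<open>v\<close> into two strands that
  both end there. The new vertices \<open>x\<close> and \<open>y\<close> keep the new edges off all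
  other paths and leave each half an inner edge owned by \<open>i\<close> alone.\<close>

lemma (in tangle) insert_visit:
  assumes v: "v \<in> V" and ik: "i < k" and vP: "v \<notin> set (P i)"
  obtains r r0 X' P' where "r \<in> I" "r0 \<notin> I"
    "tangle k V (insert r0 I) (s(r0 := v)) (t(r := v, r0 := t r)) X' P'"
    "\<And>n w. w \<in> V \<Longrightarrow> w \<in> set (P' n) \<longleftrightarrow> w \<in> set (P n) \<or> n = i \<and> w = v"
proof -
  obtain r e where r: "r \<in> I" and e: "e \<in> ce (X r)" "owners k P e = {i}"
    using path_owns[OF ik] by blast
  obtain \<alpha> \<beta> where Xr: "X r = \<alpha> @ \<beta>" "\<alpha> \<noteq> []" "\<beta> \<noteq> []" "e = {last \<alpha>, hd \<beta>}"
    using ce_splitE[OF e(1)] by metis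
  define a where "a = last \<alpha>"
  define b where "b = hd \<beta>"
  have eab: "e = {a, b}" using Xr(4) by (simp add: a_def b_def)
  obtain zs where "length zs = 2" "distinct zs" "set zs \<inter> support = {}"
    using fresh_list[OF finite_support] by metis
  then obtain x y where xy: "x \<noteq> y" "x \<notin> support" "y \<notin> support"
    by (auto simp: numeral_2_eq_2 length_Suc_conv)
  obtain r0 where r0: "r0 \<notin> I"
    using ex_new_if_finite[OF infinite_UNIV_nat finite_I] by blast
  have rr0: "r0 \<noteq> r" using r r0 by blast
  have V_supp: "V \<subseteq> support" by (auto simp: support_def)
  have mem: "a \<in> set \<alpha>" "b \<in> set \<beta>" using Xr by (simp_all add: a_def b_def)
  have disj: "set \<alpha> \<inter> set \<beta> = {}" and dist_ab: "distinct \<alpha>" "distinct \<beta>"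
    using distinct_X[OF r] Xr(1) by auto
  have supp: "set \<alpha> \<union> set \<beta> \<subseteq> support"
    using set_X_support[OF r] Xr(1) by auto
  have abV: "set \<alpha> \<inter> V = {}" "set \<beta> \<inter> V = {}"
    using X_V[OF r] Xr(1) by auto
  have dist: "a \<noteq> b" "a \<noteq> x" "a \<noteq> y" "b \<noteq> x" "b \<noteq> y" "x \<noteq> y" "a \<noteq> v" "b \<noteq> v" "v \<noteq> x" "v \<noteq> y"
    using mem disj supp xy abV v V_supp by blast+
  have iab: "{a, b} \<in> ce (P i)"
    using ownedD[OF e(2)] eab by auto
  have only: "n = i" if "n < k" "{a, b} \<in> ce (P n)" for n
    using e(2) that unfolding owners_def eab by blast
  have PV: "set (P n) \<subseteq> support" if "n < k" for n
    using set_P[OF that] unfolding support_def .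
  obtain p where p: "distinct p" "set p = set (P i) \<union> set [x, v, y]"
    "ce p = (ce (P i) - {{a, b}}) \<union> ce (a # [x, v, y] @ [b])"
    by (rule splice_path[OF distinct_P[OF ik] iab, of "[x, v, y]"])
      (use xy PV[OF ik] dist vP in auto)
  define P' where "P' = P(i := p)"
  \<comment> \<open>Strand \<open>r\<close> now stops at \<open>v\<close>; the new strand
    \<open>r0\<close> starts at \<open>v\<close> and takes over the old target.\<close>
  define X' where "X' = X(r := \<alpha> @ [x], r0 := y # \<beta>)"
  define s' where "s' = s(r0 := v)"
  define t' where "t' = t(r := v, r0 := t r)"
  define I' where "I' = insert r0 I"
  define N where "N = {{a, x}, {x, v}, {v, y}, {y, b}}"
  have ceP': "g \<in> ce (P' n) \<longleftrightarrow> (if n = i then g \<in> ce (P i) \<and> g \<noteq> {a, b} \<or> g \<in> N else g \<in> ce (P n))"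
    for g n
    using p(3) by (auto simp: P'_def N_def)
  have vPi: "g \<notin> ce (P i)" if "v \<in> g" for g
    using that vP ce_subset_set by blast
  \<comment> \<open>Every edge of \<open>N\<close> contains \<open>x\<close> or \<open>y\<close>, so
    no path had it before.\<close>
  have N_P: "g \<notin> ce (P n)" if "n < k" "g \<in> N" for g n
  proof
    assume "g \<in> ce (P n)"
    then have "g \<subseteq> support" using ce_P_support[OF that(1)] by blast
    then show False using that(2) xy by (auto simp: N_def)
  qed
  have abN: "{a, b} \<notin> N" using dist by (auto simp: N_def doubleton_eq_iff)
  have own_N: "owners k P' g = {i}" if "g \<in> N" for g
    using that N_P[OF _ that] ik unfolding owners_def ceP' by auto
  have own_ab: "owners k P' {a, b} = {}"
    using only abN unfolding owners_def ceP' by auto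
  have own: "owners k P' g = owners k P g" if "g \<noteq> {a, b}" "g \<notin> N" for g
  proof -
    have "g \<in> ce (P' n) \<longleftrightarrow> g \<in> ce (P n)" for n
      using that by (simp add: ceP')
    then show ?thesis by (simp add: owners_def)
  qed
  have N_supp: "\<not> g \<subseteq> support" if "g \<in> N" for g
    using that xy by (auto simp: N_def)
  have parity': "{g. odd (card (owners k P' g))} = {g. odd (card (owners k P g))} - {{a, b}} \<union> N"
  proof (intro set_eqI)
    fix g
    consider "g = {a, b}" | "g \<in> N" | "g \<noteq> {a, b}" "g \<notin> N" by blast
    then show "g \<in> {g. odd (card (owners k P' g))} \<longleftrightarrow>
        g \<in> {g. odd (card (owners k P g))} - {{a, b}} \<union> N"
    proof cases
      case 1
      then show ?thesis using own_ab abN by simp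
    next
      case 2
      then show ?thesis using own_N[OF 2] by simp
    next
      case 3
      then show ?thesis using own by simp
    qed
  qed
  define Rest where "Rest = (\<Union>l\<in>I - {r}. ce (s l # X l @ [t l]))"
  define A where "A = ce (s r # \<alpha>) \<union> ce (\<beta> @ [t r])"
  have X'r: "X' r = \<alpha> @ [x]" "X' r0 = y # \<beta>" "s' r = s r" "s' r0 = v" "t' r = v" "t' r0 = t r"
    using rr0 by (simp_all add: X'_def s'_def t'_def)
  have X'_other: "X' l = X l" "s' l = s l" "t' l = t l" if "l \<noteq> r" "l \<noteq> r0" for l
    using that by (simp_all add: X'_def s'_def t'_def)
  have X'_rest: "X' l = X l" "s' l = s l" "t' l = t l" if "l \<in> I - {r}" for l
    using X'_other[of l] that r0 by (cases "l = r0", simp_all)+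
  have old: "(\<Union>l\<in>I. ce (s l # X l @ [t l])) = A \<union> Rest \<union> {{a, b}}"
  proof -
    have old_r: "ce (s r # X r @ [t r]) = ce (s r # \<alpha>) \<union> {{a, b}} \<union> ce (\<beta> @ [t r])"
      using ce_append[of "s r # \<alpha>" "\<beta> @ [t r]"] Xr(1-3) by (simp add: a_def b_def)
    have "(\<Union>l\<in>I. F l) = F r \<union> (\<Union>l\<in>I - {r}. F l)" for F :: "nat \<Rightarrow> 'a set set"
      using r by blast
    from this[of "\<lambda>l. ce (s l # X l @ [t l])"] show ?thesis
      unfolding old_r A_def Rest_def by blast
  qed
  have new: "(\<Union>l\<in>I'. ce (s' l # X' l @ [t' l])) = A \<union> Rest \<union> N"
  proof -
    have new_r: "ce (s' r # X' r @ [t' r]) = ce (s r # \<alpha>) \<union> {{a, x}, {x, v}}"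
      using ce_append_single[of "s r # \<alpha>" "[v]" x] Xr(2) unfolding X'r by (simp add: a_def)
    have new_r0: "ce (s' r0 # X' r0 @ [t' r0]) = {{v, y}, {y, b}} \<union> ce (\<beta> @ [t r])"
      using ce_append_single[of "[v]" "\<beta> @ [t r]" y] Xr(3) unfolding X'r by (simp add: b_def)
    have rest: "(\<Union>l\<in>I - {r}. ce (s' l # X' l @ [t' l])) = Rest"
      unfolding Rest_def by (rule SUP_cong) (simp_all only: X'_rest)
    have "(\<Union>l\<in>I'. F l) = F r \<union> F r0 \<union> (\<Union>l\<in>I - {r}. F l)" for F :: "nat \<Rightarrow> 'a set set"
      using r unfolding I'_def by blast
    from this[of "\<lambda>l. ce (s' l # X' l @ [t' l])"] show ?thesis
      unfolding new_r new_r0 rest A_def N_def by blast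
  qed
  have notA: "{a, b} \<notin> A \<union> Rest"
  proof -
    have "b \<notin> set (s r # \<alpha>)" "a \<notin> set (\<beta> @ [t r])"
      using abV ends[OF r] mem disj by auto
    moreover have "a \<notin> set (s l # X l @ [t l])" if "l \<in> I - {r}" for l
      using abV ends[of l] X_X[of l r] mem Xr(1) that r by auto
    ultimately show ?thesis
      unfolding A_def Rest_def by (auto dest!: ce_subset_set)
  qed
  have X'_subset: "set (X' r) = set \<alpha> \<union> {x}" "set (X' r0) = {y} \<union> set \<beta>"
    unfolding X'r by auto
  have support': "V \<union> (\<Union>l\<in>I'. set (X' l)) = support \<union> {x, y}"
  proof -
    have split: "(\<Union>l\<in>I. F l) = F r \<union> (\<Union>l\<in>I - {r}. F l)" for F :: "nat \<Rightarrow> 'a set"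
      using r by blast
    have split': "(\<Union>l\<in>I'. F l) = F r \<union> F r0 \<union> (\<Union>l\<in>I - {r}. F l)" for F :: "nat \<Rightarrow> 'a set"
      using r unfolding I'_def by blast
    have rest: "(\<Union>l\<in>I - {r}. set (X' l)) = (\<Union>l\<in>I - {r}. set (X l))"
      by (rule SUP_cong) (simp_all only: X'_rest)
    show ?thesis
      unfolding support_def split'[of "\<lambda>l. set (X' l)"] split[of "\<lambda>l. set (X l)"] rest
        X'_subset Xr(1) set_append by blast
  qed
  have ceX': "ce (X' r) = ce \<alpha> \<union> {{a, x}}" "ce (X' r0) = {{y, b}} \<union> ce \<beta>"
    unfolding X'r using ce_append[of \<alpha> "[x]"] ce_append[of "[y]" \<beta>] Xr(2,3)
    by (simp_all add: a_def b_def)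
  have ceX: "ce (X r) = ce \<alpha> \<union> {{a, b}} \<union> ce \<beta>"
    unfolding Xr(1) using ce_append[of \<alpha> \<beta>] Xr(2,3) by (simp add: a_def b_def)
  have own_X: "owners k P' g = owners k P g" if "l \<in> I" "g \<in> ce (X l)" "g \<noteq> {a, b}" for l g
  proof (rule own[OF that(3)])
    show "g \<notin> N"
      using N_supp ce_subset_set[OF that(2)] set_X_support[OF that(1)] by blast
  qed
  have not_ab: "g \<noteq> {a, b}" if "l \<in> I" "l \<noteq> r" "g \<in> ce (X l)" for l g
    using ce_subset_set[OF that(3)] X_X[of l r] mem Xr(1) that r by auto
  have own_ax: "owners k P' {a, x} = {i}" and own_yb: "owners k P' {y, b} = {i}"
    using own_N by (simp_all add: N_def)
  have cases_I': thesis' if "l \<in> I'" "l = r \<Longrightarrow> thesis'" "l = r0 \<Longrightarrow> thesis'"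
    "l \<in> I \<Longrightarrow> l \<noteq> r \<Longrightarrow> l \<noteq> r0 \<Longrightarrow> thesis'" for l thesis'
    using that r0 unfolding I'_def by blast
  have "tangle k V I' s' t' X' P'"
  proof
    show "finite I'" "finite V" using finite_I finite_V by (simp_all add: I'_def)
    show "distinct (P' n)" if "n < k" for n
      using distinct_P[OF that] p(1) by (simp add: P'_def)
    show "set (P' n) \<subseteq> V \<union> (\<Union>l\<in>I'. set (X' l))" if "n < k" for n
      unfolding support' using PV[OF that] PV[OF ik] p(2) v V_supp by (auto simp: P'_def)
    show "s' l \<in> V \<and> t' l \<in> V" if "l \<in> I'" for l
      using ends that r v by (auto simp: s'_def t'_def I'_def)
    show "distinct (X' l)" if "l \<in> I'" for l
      using that
    proof (rule cases_I')
      assume "l = r"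
      then show ?thesis using dist_ab supp xy by (auto simp: X'r)
    next
      assume "l = r0"
      then show ?thesis using dist_ab supp xy by (auto simp: X'r)
    next
      assume "l \<in> I" "l \<noteq> r" "l \<noteq> r0"
      then show ?thesis using distinct_X by (simp add: X'_other(1))
    qed
    show "set (X' l) \<inter> V = {}" if "l \<in> I'" for l
      using that
    proof (rule cases_I')
      assume "l = r"
      then show ?thesis using abV xy V_supp X'_subset(1) by auto
    next
      assume "l = r0"
      then show ?thesis using abV xy V_supp X'_subset(2) by auto
    next
      assume "l \<in> I" "l \<noteq> r" "l \<noteq> r0"
      then show ?thesis using X_V by (simp add: X'_other(1))
    qed
    have rr0_disj: "set (X' r) \<inter> set (X' r0) = {}"
      using disj supp xy unfolding X'_subset by blast
    have r_disj: "set (X' r) \<inter> set (X' m) = {}" "set (X' r0) \<inter> set (X' m) = {}"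
      if m: "m \<in> I" "m \<noteq> r" "m \<noteq> r0" for m
    proof -
      have "(set \<alpha> \<union> set \<beta>) \<inter> set (X m) = {}"
        using X_X[OF r m(1)] m(2) Xr(1) by auto
      then show "set (X' r) \<inter> set (X' m) = {}" "set (X' r0) \<inter> set (X' m) = {}"
        using set_X_support[OF m(1)] xy unfolding X'_subset X'_other(1)[OF m(2,3)] by blast+
    qed
    show "set (X' l) \<inter> set (X' l') = {}" if l: "l \<in> I'" "l' \<in> I'" "l \<noteq> l'" for l l'
    proof (rule cases_I'[OF l(1)]; rule cases_I'[OF l(2)])
      assume "l \<in> I" "l \<noteq> r" "l \<noteq> r0" "l' \<in> I" "l' \<noteq> r" "l' \<noteq> r0"
      then show ?thesis using X_X[of l l'] l(3) by (simp add: X'_other(1))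
    qed (use l(3) rr0_disj r_disj[of l] r_disj[of l'] in auto)
    show "{g. odd (card (owners k P' g))} = (\<Union>l\<in>I'. ce (s' l # X' l @ [t' l]))"
      unfolding parity' parity new old using notA by blast
    show "\<exists>m. \<exists>g\<in>ce (X' l). owners k P' g = {m}" if "l \<in> I'" for l
      using that
    proof (rule cases_I')
      assume "l = r"
      then show ?thesis using own_ax ceX' by blast
    next
      assume "l = r0"
      then show ?thesis using own_yb ceX' by blast
    next
      assume l: "l \<in> I" "l \<noteq> r" "l \<noteq> r0"
      obtain m g where g: "g \<in> ce (X l)" "owners k P g = {m}"
        using strand_owned[OF l(1)] by blast
      then have "owners k P' g = {m}"
        using own_X[OF l(1) g(1) not_ab[OF l(1,2) g(1)]] by simp
      then show ?thesis using g(1) X'_other(1)[OF l(2,3)] by auto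
    qed
    show "\<exists>l\<in>I'. \<exists>g\<in>ce (X' l). owners k P' g = {m}" if m: "m < k" for m
    proof (cases "m = i")
      case True
      then show ?thesis using own_ax ceX' r unfolding I'_def by blast
    next
      case False
      obtain l g where g: "l \<in> I" "g \<in> ce (X l)" "owners k P g = {m}"
        using path_owns[OF m] by blast
      then have nab: "g \<noteq> {a, b}" using False e(2) eab by auto
      then have own_g: "owners k P' g = {m}" using own_X g by blast
      have "\<exists>l'\<in>I'. g \<in> ce (X' l')"
      proof (cases "l = r")
        case True
        then have "g \<in> ce (X' r) \<or> g \<in> ce (X' r0)"
          using g(2) nab unfolding ceX' ceX by (simp add: ceX) blast
        then show ?thesis using r unfolding I'_def by blast
      next
        case False
        then have "ce (X' l) = ce (X l)" using g(1) X'_rest(1)[of l] by simp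
        then show ?thesis using g(1,2) unfolding I'_def by blast
      qed
      then show ?thesis using own_g by blast
    qed
  qed
  moreover have "w \<in> set (P' n) \<longleftrightarrow> w \<in> set (P n) \<or> n = i \<and> w = v" if "w \<in> V" for n w
    using p(2) that V_supp xy by (auto simp: P'_def)
  ultimately show ?thesis
    using that[OF r r0] unfolding I'_def s'_def t'_def by blast
qed

text \<open>\<open>m v\<close> is the number of visits still to be added at \<open>v\<close>; the
  induction is on their total. A path can visit \<open>v\<close> only once, and the bound guarantees
  that some path misses \<open>v\<close> as long as \<open>m v\<close> is positive.\<close>

lemma realizable_increase_degrees:
  assumes "tangle k V I s t X P"
    and "\<And>v. v \<in> V \<Longrightarrow> card {i. i < k \<and> v \<in> set (P i)} + m v \<le> k"
  shows "\<exists>I' s' t'. realizable k V I' s' t' \<and>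
    (\<forall>v\<in>V. end_degree I' s' t' v = end_degree I s t v + 2 * m v)"
  using assms
proof (induction "\<Sum>v\<in>V. m v" arbitrary: I s t X P m)
  case 0
  interpret tangle k V I s t X P by (rule 0(2))
  have "\<forall>v\<in>V. m v = 0" using 0(1) finite_V by simp
  then have "realizable k V I s t \<and> (\<forall>v\<in>V. end_degree I s t v = end_degree I s t v + 2 * m v)"
    using 0(2) unfolding realizable_def by auto
  then show ?case by blast
next
  case (Suc n)
  interpret tangle k V I s t X P by (rule Suc.prems(1))
  obtain v where v: "v \<in> V" "0 < m v"
    using Suc.hyps(2) by (metis gr0I sum.neutral zero_neq_one Suc_neq_Zero)
  have "\<exists>i<k. v \<notin> set (P i)"
  proof (rule ccontr)
    assume "\<not> ?thesis"
    then have "{i. i < k \<and> v \<in> set (P i)} = {..<k}" by auto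
    then show False using Suc.prems(2)[OF v(1)] v(2) by simp
  qed
  then obtain i where i: "i < k" "v \<notin> set (P i)" by blast
  obtain r r0 X' P' where r: "r \<in> I" "r0 \<notin> I"
    and T': "tangle k V (insert r0 I) (s(r0 := v)) (t(r := v, r0 := t r)) X' P'"
    and P': "\<And>n w. w \<in> V \<Longrightarrow> w \<in> set (P' n) \<longleftrightarrow> w \<in> set (P n) \<or> n = i \<and> w = v"
    using insert_visit[OF v(1) i] by metis
  define m' where "m' = m(v := m v - 1)"
  have "n = sum m' V"
    using Suc.hyps(2) v finite_V sum.remove[of V v m] sum.remove[of V v m']
    by (simp add: m'_def)
  moreover have "card {j. j < k \<and> w \<in> set (P' j)} + m' w \<le> k" if w: "w \<in> V" for w
  proof (cases "w = v")
    case True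
    have "{j. j < k \<and> v \<in> set (P' j)} = insert i {j. j < k \<and> v \<in> set (P j)}"
      using P'[OF v(1)] i by auto
    then have "card {j. j < k \<and> v \<in> set (P' j)} \<le> Suc (card {j. j < k \<and> v \<in> set (P j)})"
      by (simp add: card_insert_le_m1 card_insert_if)
    then show ?thesis using Suc.prems(2)[OF v(1)] v(2) True by (simp add: m'_def)
  next
    case False
    then have "{j. j < k \<and> w \<in> set (P' j)} = {j. j < k \<and> w \<in> set (P j)}"
      using P'[OF w] by auto
    then show ?thesis using Suc.prems(2)[OF w] False by (simp add: m'_def)
  qed
  ultimately obtain I' s' t' where I': "realizable k V I' s' t'"
    "\<forall>w\<in>V. end_degree I' s' t' w =
      end_degree (insert r0 I) (s(r0 := v)) (t(r := v, r0 := t r)) w + 2 * m' w"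
    using Suc.hyps(1)[OF _ T'] by blast
  \<comment> \<open>The old target passes from \<open>r\<close> to \<open>r0\<close>, and
    \<open>v\<close> becomes an end of both, so only \<open>v\<close> gains, by two.\<close>
  have deg: "end_degree (insert r0 I) (s(r0 := v)) (t(r := v, r0 := t r)) w =
      end_degree I s t w + 2 * of_bool (w = v)" for w
  proof -
    have rr0: "r0 \<noteq> r" and I0: "insert r0 I - {r0} = I" using r by auto
    have fin: "finite (insert r0 I)" using finite_I by simp
    have "end_degree (I - {r}) (s(r0 := v)) (t(r := v, r0 := t r)) w = end_degree (I - {r}) s t w"
      using r by (intro end_degree_cong) auto
    then show ?thesis
      using end_degree_remove[OF fin insertI1, of "s(r0 := v)" "t(r := v, r0 := t r)" w]
        end_degree_remove[OF finite_I r(1), of "s(r0 := v)" "t(r := v, r0 := t r)" w]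
        end_degree_remove[OF finite_I r(1), of s t w] rr0
      unfolding I0 by auto
  qed
  have "end_degree I' s' t' w = end_degree I s t w + 2 * m w" if "w \<in> V" for w
    using I'(2) that v(2) unfolding deg by (auto simp: m'_def)
  then show ?case using I'(1) by blast
qed

text \<open>The start has \<open>k\<close> edge-disjoint paths, each consisting of a single strand.
  \<open>L\<close> lists the \<open>2 * k\<close> path ends, path \<open>i\<close> taking the
  entries \<open>i\<close> and \<open>i + k\<close>.\<close>

lemma base_tangle:
  fixes V :: "'a::infinite set"
  assumes "finite V" and LV: "\<And>j. j < 2 * k \<Longrightarrow> L j \<in> V"
    and L_neq: "\<And>i. i < k \<Longrightarrow> L i \<noteq> L (i + k)"
  obtains X P where "tangle k V {..<k} L (\<lambda>i. L (i + k)) X P"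
    "\<And>i. i < k \<Longrightarrow> set (P i) \<inter> V = {L i, L (i + k)}"
proof -
  obtain hs where hs: "length hs = 2 * k" "distinct hs" "set hs \<inter> V = {}"
    using fresh_list[OF assms(1)] by metis
  \<comment> \<open>Two new vertices per path, so that each strand has an inner edge to be
    owned.\<close>
  define X where "X i = [hs ! i, hs ! (i + k)]" for i
  define P where "P i = L i # X i @ [L (i + k)]" for i
  have in_V: "L i \<in> V" "L (i + k) \<in> V" if "i < k" for i
    using LV that by auto
  have hsV: "hs ! j \<notin> V" if "j < 2 * k" for j
    using hs(1,3) that nth_mem[of j hs] by (metis disjoint_iff)
  have hs_inj: "hs ! j = hs ! l \<longleftrightarrow> j = l" if "j < 2 * k" "l < 2 * k" for j l
    using hs(1,2) that by (simp add: nth_eq_iff_index_eq)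
  have X_V: "set (X i) \<inter> V = {}" if "i < k" for i
    using that hsV by (simp add: X_def)
  have X_X: "set (X i) \<inter> set (X j) = {}" if "i < k" "j < k" "i \<noteq> j" for i j
    using that hs_inj by (auto simp: X_def)
  \<comment> \<open>Every edge of a path meets its own inner vertices, and these are private to it.
    Hence no two paths share an edge.\<close>
  have ce_P: "e \<inter> set (X i) \<noteq> {}" if "e \<in> ce (P i)" for e i
    using that by (auto simp: P_def X_def)
  have only: "j = i" if "i < k" "j < k" "e \<in> ce (P i)" "e \<in> ce (P j)" for e i j
  proof (rule ccontr)
    assume "j \<noteq> i"
    moreover have "e \<subseteq> set (X j) \<union> V"
      using ce_subset_set[OF that(4)] in_V[OF that(2)] by (auto simp: P_def)
    ultimately show False
      using ce_P[OF that(3)] X_V[OF that(1)] X_X[OF that(1,2)] by blast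
  qed
  have own: "owners k P e = {i}" if "i < k" "e \<in> ce (P i)" for e i
    using only[OF that(1) _ that(2)] that unfolding owners_def by blast
  have own_X: "\<exists>e\<in>ce (X i). owners k P e = {i}" if "i < k" for i
    using own[OF that] by (simp add: P_def X_def)
  have "tangle k V {..<k} L (\<lambda>i. L (i + k)) X P"
  proof
    show "distinct (P i)" if "i < k" for i
      using L_neq[OF that] in_V[OF that] X_V[OF that] hs_inj[of i "i + k"] that
      by (auto simp: P_def X_def)
    show "set (P i) \<subseteq> V \<union> (\<Union>r\<in>{..<k}. set (X r))" if "i < k" for i
      using in_V[OF that] that by (auto simp: P_def)
    show "distinct (X i)" if "i \<in> {..<k}" for i
      using hs_inj[of i "i + k"] that by (simp add: X_def)
    show "{e. odd (card (owners k P e))} = (\<Union>r\<in>{..<k}. ce (L r # X r @ [L (r + k)]))"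
    proof (intro set_eqI iffI)
      fix e assume "e \<in> {e. odd (card (owners k P e))}"
      then have "owners k P e \<noteq> {}" by auto
      then show "e \<in> (\<Union>r\<in>{..<k}. ce (L r # X r @ [L (r + k)]))"
        unfolding owners_def P_def by blast
    next
      fix e assume "e \<in> (\<Union>r\<in>{..<k}. ce (L r # X r @ [L (r + k)]))"
      then obtain i where "i < k" "e \<in> ce (P i)" unfolding P_def by blast
      then show "e \<in> {e. odd (card (owners k P e))}" using own by simp
    qed
    show "\<exists>i. \<exists>e\<in>ce (X r). owners k P e = {i}" if "r \<in> {..<k}" for r
      using own_X that by blast
    show "\<exists>r\<in>{..<k}. \<exists>e\<in>ce (X r). owners k P e = {i}" if "i < k" for i
      using own_X that by blast
  qed (use assms(1) in_V X_V X_X in auto)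
  moreover have "set (P i) \<inter> V = {L i, L (i + k)}" if "i < k" for i
    using in_V[OF that] X_V[OF that] by (auto simp: P_def)
  ultimately show ?thesis using that by blast
qed

section \<open>Subdivisions\<close>

lemma subdivision_trans:
  assumes "subdivision G H" "subdivision H K"
  shows "subdivision G K"
  using assms(2)
proof induction
  case (step K u v xs)
  then show ?case by (intro subdivision.step)
qed (rule assms(1))

lemma simple_graphD:
  assumes "simple_graph G"
  shows "finite (verts G)" "finite (edges G)" "e \<in> edges G \<Longrightarrow> e \<subseteq> verts G"
    "e \<in> edges G \<Longrightarrow> card e = 2"
proof -
  show "finite (verts G)" "e \<in> edges G \<Longrightarrow> e \<subseteq> verts G" "e \<in> edges G \<Longrightarrow> card e = 2"
    using assms by (auto simp: simple_graph_def)
  have "edges G \<subseteq> Pow (verts G)"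
    using assms by (auto simp: simple_graph_def)
  then show "finite (edges G)"
    by (rule finite_subset) (simp add: \<open>finite (verts G)\<close>)
qed

text \<open>The inserted path has degree one at \<open>u\<close> and \<open>v\<close>, which makes
  up for the removed edge, and degree two at its inner vertices.\<close>

lemma subdivide_edge:
  assumes G: "simple_graph G" and uv: "{u, v} \<in> edges G"
    and xs: "distinct xs" "set xs \<inter> verts G = {}"
  defines "H \<equiv> Graph (verts G \<union> set xs) ((edges G - {{u, v}}) \<union> ce (u # xs @ [v]))"
  shows "simple_graph H"
    and "w \<in> verts G \<Longrightarrow> degree H w = degree G w"
    and "w \<in> set xs \<Longrightarrow> degree H w = 2"
proof -
  have "card {u, v} = 2" using simple_graphD(4)[OF G uv] .
  then have uv_neq: "u \<noteq> v" by (auto simp: card_insert_if split: if_splits)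
  have uvG: "u \<in> verts G" "v \<in> verts G" using simple_graphD(3)[OF G uv] by auto
  define p where "p = u # xs @ [v]"
  have p: "distinct p" "hd p = u" "last p = v" "set p = {u, v} \<union> set xs" "p \<noteq> []"
    using xs uv_neq uvG by (auto simp: p_def)
  have H: "verts H = verts G \<union> set xs" "edges H = (edges G - {{u, v}}) \<union> ce p"
    by (simp_all add: H_def p_def)
  show "simple_graph H"
    unfolding simple_graph_def H
  proof (intro conjI ballI)
    fix e assume e: "e \<in> edges G - {{u, v}} \<union> ce p"
    then show "e \<subseteq> verts G \<union> set xs"
      using simple_graphD(3)[OF G, of e] ce_subset_set[of e p] p(4) uvG by auto
    show "card e = 2"
      using e simple_graphD(4)[OF G, of e] card_of_ce[OF p(1), of e] by auto
  qed (simp add: simple_graphD(1)[OF G])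
  \<comment> \<open>Needed to add the two degree counts. An old edge on the inserted path avoids the
    new vertices, so it can only be \<open>uv\<close>, which has been removed.\<close>
  have disj: "(edges G - {{u, v}}) \<inter> ce p = {}"
  proof (rule ccontr)
    assume "\<not> ?thesis"
    then obtain e where e: "e \<in> edges G" "e \<noteq> {u, v}" "e \<in> ce p" by blast
    then have "e \<subseteq> {u, v}"
      using simple_graphD(3)[OF G e(1)] ce_subset_set[OF e(3)] p(4) xs(2) by blast
    moreover have "card e = 2" by (rule simple_graphD(4)[OF G e(1)])
    ultimately have "e = {u, v}" using uv_neq by (intro card_seteq) auto
    then show False using e(2) by blast
  qed
  have fin: "finite (edges G)" by (rule simple_graphD(2)[OF G])
  have deg: "degree H x = card {e \<in> edges G - {{u, v}}. x \<in> e} + path_degree p x" for x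
  proof -
    have "{e \<in> edges H. x \<in> e} = {e \<in> edges G - {{u, v}}. x \<in> e} \<union> {e \<in> ce p. x \<in> e}"
      unfolding H by blast
    then show ?thesis
      unfolding degree_def path_degree_def using disj fin by (simp add: card_Un_disjoint disjoint_iff)
  qed
  have degG: "degree G x = card {e \<in> edges G - {{u, v}}. x \<in> e} + of_bool (x \<in> {u, v})" for x
  proof -
    have "{e \<in> edges G. x \<in> e} = (if x \<in> {u, v} then insert {u, v} {e \<in> edges G - {{u, v}}. x \<in> e}
        else {e \<in> edges G - {{u, v}}. x \<in> e})"
      using uv by auto
    then show ?thesis unfolding degree_def using fin by simp
  qed
  show "degree H w = degree G w" if "w \<in> verts G"
  proof -
    have "w \<notin> set xs" using that xs(2) by blast
    then show ?thesis
      using path_degree_eq[OF p(1,5), of w] uv_neq unfolding deg degG p(2-4) by (auto split: if_splits)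
  qed
  show "degree H w = 2" if "w \<in> set xs"
  proof -
    have w: "w \<notin> verts G" using that xs(2) by blast
    have none: "{e \<in> edges G - {{u, v}}. w \<in> e} = {}"
      using simple_graphD(3)[OF G] w by blast
    have "w \<noteq> u" "w \<noteq> v" using w uvG by auto
    then show ?thesis
      using path_degree_eq[OF p(1,5), of w] that unfolding deg p(2-4) none by simp
  qed
qed

lemma subdivision_degree:
  assumes "subdivision G H" "simple_graph G"
  shows "simple_graph H \<and> verts G \<subseteq> verts H \<and> (\<forall>v\<in>verts G. degree H v = degree G v)"
  using assms(1)
proof induction
  case refl
  then show ?case using assms(2) by simp
next
  case (step H u v xs)
  then have H: "simple_graph H" by blast
  show ?case
    using step.IH subdivide_edge(1,2)[OF H step.hyps(2-4)] by auto
qed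

text \<open>The edges are subdivided one at a time. By injectivity the next edge has not been
  replaced yet.\<close>

lemma subdivision_strands:
  assumes G: "simple_graph G" and "finite J" and inj: "inj_on (\<lambda>r. {s r, t r}) J"
    and sub: "(\<lambda>r. {s r, t r}) ` J \<subseteq> edges G"
    and X: "\<And>r. r \<in> J \<Longrightarrow> X r \<noteq> []" "\<And>r. r \<in> J \<Longrightarrow> distinct (X r)"
      "\<And>r. r \<in> J \<Longrightarrow> set (X r) \<inter> verts G = {}"
    and XX: "\<And>r r'. r \<in> J \<Longrightarrow> r' \<in> J \<Longrightarrow> r \<noteq> r' \<Longrightarrow> set (X r) \<inter> set (X r') = {}"
  shows "subdivision G (Graph (verts G \<union> (\<Union>r\<in>J. set (X r)))
    ((edges G - (\<lambda>r. {s r, t r}) ` J) \<union> (\<Union>r\<in>J. ce (s r # X r @ [t r]))))"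
  using assms(2-)
proof (induction J rule: finite_induct)
  case empty
  then show ?case using subdivision.refl[of G] by simp
next
  case (insert j J)
  define H where "H = Graph (verts G \<union> (\<Union>r\<in>J. set (X r)))
    ((edges G - (\<lambda>r. {s r, t r}) ` J) \<union> (\<Union>r\<in>J. ce (s r # X r @ [t r])))"
  have H: "subdivision G H"
    unfolding H_def by (rule insert.IH) (use insert.prems in auto)
  have jG: "{s j, t j} \<in> edges G" using insert.prems(2) by auto
  have j_J: "{s j, t j} \<notin> (\<lambda>r. {s r, t r}) ` J"
    using insert.prems(1) insert.hyps(2) by (simp add: inj_on_insert)
  \<comment> \<open>Every edge of a strand contains a vertex outside \<open>G\<close>, as
    \<open>X r\<close> is nonempty. So removing the next edge of \<open>G\<close> takes nothing away
    from the strands already inserted.\<close>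
  have not_strand: "{s j, t j} \<notin> (\<Union>r\<in>J. ce (s r # X r @ [t r]))"
  proof
    assume "{s j, t j} \<in> (\<Union>r\<in>J. ce (s r # X r @ [t r]))"
    then obtain r where r: "r \<in> J" and e: "{s j, t j} \<in> ce (s r # X r @ [t r])" by blast
    have XG: "set (X r) \<inter> verts G = {}" using insert.prems(5) r by blast
    have jV: "{s j, t j} \<subseteq> verts G" by (rule simple_graphD(3)[OF G jG])
    have "X r \<noteq> []" using insert.prems(3) r by blast
    then have ce_eq: "ce (s r # X r @ [t r]) = {{s r, hd (X r)}} \<union> ce (X r) \<union> {{last (X r), t r}}"
      and hl: "hd (X r) \<in> set (X r)" "last (X r) \<in> set (X r)"
      using ce_append[of "[s r]" "X r @ [t r]"] ce_append[of "X r" "[t r]"] by simp_all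
    then have notG: "hd (X r) \<notin> verts G" "last (X r) \<notin> verts G" using XG by blast+
    from e[unfolded ce_eq] consider "{s j, t j} = {s r, hd (X r)}" | "{s j, t j} \<in> ce (X r)"
      | "{s j, t j} = {last (X r), t r}" by blast
    then show False
    proof cases
      case 2
      then show ?thesis using ce_subset_set[OF 2] XG jV by blast
    qed (use jV notG in simp_all)
  qed
  have "subdivision G (Graph (verts H \<union> set (X j))
      ((edges H - {{s j, t j}}) \<union> ce (s j # X j @ [t j])))"
  proof (rule subdivision.step[OF H])
    show "{s j, t j} \<in> edges H" using jG j_J by (simp add: H_def)
    show "distinct (X j)" using insert.prems(4) by blast
    have "set (X r) \<inter> set (X j) = {}" if "r \<in> J" for r
      using insert.prems(6)[of r j] insert.hyps(2) that by blast
    then show "set (X j) \<inter> verts H = {}" using insert.prems(5)[of j] by (auto simp: H_def)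
  qed
  moreover have "verts H \<union> set (X j) = verts G \<union> (\<Union>r\<in>insert j J. set (X r))"
    by (auto simp: H_def)
  moreover have "(edges H - {{s j, t j}}) \<union> ce (s j # X j @ [t j]) =
      (edges G - (\<lambda>r. {s r, t r}) ` insert j J) \<union> (\<Union>r\<in>insert j J. ce (s r # X r @ [t r]))"
  proof -
    have "edges H - {{s j, t j}} =
        (edges G - (\<lambda>r. {s r, t r}) ` insert j J) \<union> (\<Union>r\<in>J. ce (s r # X r @ [t r]))"
      using not_strand by (auto simp: H_def)
    then show ?thesis by auto
  qed
  ultimately show ?case by simp
qed

section \<open>From tangles to path odd-covers\<close>

lemma p2_le: "path_odd_cover G \<P> \<Longrightarrow> p2 G \<le> card \<P>"
  unfolding p2_def by (rule Least_le) blast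

lemma p2_top_le: "subdivision G H \<Longrightarrow> p2_top G \<le> p2 H"
  unfolding p2_top_def by (rule Least_le) blast

text \<open>The paths of the tangle form a path odd-cover of the union of its strands, by
  \<open>parity\<close>.\<close>

lemma (in tangle) p2_le_tangle:
  "p2 (Graph (V \<union> (\<Union>r\<in>I. set (X r))) (\<Union>r\<in>I. ce (s r # X r @ [t r]))) \<le> k"
proof -
  define g where "g i = Graph (set (P i)) (ce (P i))" for i
  have nonempty: "P i \<noteq> []" if "i < k" for i
    using path_owns[OF that] by (auto dest: ownedD)
  \<comment> \<open>A cover is a set of graphs, so equal paths would merge and spoil the parity
    count. They are distinct because each of them alone owns some edge.\<close>
  have inj: "inj_on g {..<k}"
  proof (rule inj_onI)
    fix i j assume ij: "i \<in> {..<k}" "j \<in> {..<k}" "g i = g j"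
    obtain e where e: "owners k P e = {i}" using path_owns[of i] ij(1) by blast
    then have "e \<in> ce (P i)" using ownedD by blast
    then have "j \<in> owners k P e" using ij by (simp add: owners_def g_def)
    then show "i = j" using e by simp
  qed
  have count: "card {Q \<in> g ` {..<k}. e \<in> edges Q} = card (owners k P e)" for e
  proof -
    have "{Q \<in> g ` {..<k}. e \<in> edges Q} = g ` owners k P e"
      by (auto simp: owners_def g_def)
    moreover have "inj_on g (owners k P e)"
      by (rule inj_on_subset[OF inj]) (auto simp: owners_def)
    ultimately show ?thesis by (simp add: card_image)
  qed
  have "path_odd_cover (Graph (V \<union> (\<Union>r\<in>I. set (X r))) (\<Union>r\<in>I. ce (s r # X r @ [t r]))) (g ` {..<k})"
    unfolding path_odd_cover_def count
  proof (intro conjI ballI)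
    fix Q assume "Q \<in> g ` {..<k}"
    then obtain i where i: "i < k" "Q = g i" by auto
    show "is_path Q"
      unfolding is_path_def i(2) g_def using nonempty[OF i(1)] distinct_P[OF i(1)] by blast
    show "verts Q \<subseteq> verts (Graph (V \<union> (\<Union>r\<in>I. set (X r))) (\<Union>r\<in>I. ce (s r # X r @ [t r])))"
      using set_P[OF i(1)] by (simp add: i(2) g_def)
  qed (simp_all add: parity)
  then have "p2 (Graph (V \<union> (\<Union>r\<in>I. set (X r))) (\<Union>r\<in>I. ce (s r # X r @ [t r]))) \<le> card (g ` {..<k})"
    by (rule p2_le)
  then show ?thesis using card_image_le[of "{..<k}" g] by simp
qed

section \<open>The upper bound for at least two paths\<close>

text \<open>Reduces the upper bound to a choice of path ends. If \<open>D\<close> ends lie at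
  \<open>v\<close>, then \<open>m\<close> visits in passing give the degree
  \<open>D + 2 * m\<close>, and \<open>D + m \<le> k\<close> says that there are enough paths for
  these visits. Starting from \<open>base_tangle\<close>, the visits are added, the strand ends are
  matched with the edges of \<open>G\<close>, and the strands then form a subdivision.\<close>

lemma p2_top_le_of_ends:
  fixes G :: "'a::infinite graph"
  assumes G: "simple_graph G" and k: "2 \<le> k"
    and LV: "\<And>j. j < 2 * k \<Longrightarrow> L j \<in> verts G"
    and L_neq: "\<And>i. i < k \<Longrightarrow> L i \<noteq> L (i + k)"
    and deg: "\<And>v. v \<in> verts G \<Longrightarrow>
      \<exists>m. degree G v = card {j. j < 2 * k \<and> L j = v} + 2 * m \<and> card {j. j < 2 * k \<and> L j = v} + m \<le> k"
  shows "p2_top G \<le> k"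
proof -
  define D where "D v = card {j. j < 2 * k \<and> L j = v}" for v
  have "\<forall>v\<in>verts G. \<exists>m. degree G v = D v + 2 * m \<and> D v + m \<le> k"
    using deg unfolding D_def by blast
  from bchoice[OF this] obtain m
    where m: "\<And>v. v \<in> verts G \<Longrightarrow> degree G v = D v + 2 * m v \<and> D v + m v \<le> k" by blast
  have fin: "finite (verts G)" by (rule simple_graphD(1)[OF G])
  obtain X P where T: "tangle k (verts G) {..<k} L (\<lambda>i. L (i + k)) X P"
    and PV: "\<And>i. i < k \<Longrightarrow> set (P i) \<inter> verts G = {L i, L (i + k)}"
    using base_tangle[where k = k and L = L, OF fin LV L_neq] by blast
  have D: "end_degree {..<k} L (\<lambda>i. L (i + k)) v = D v" for v
  proof -
    have split: "{j. j < 2 * k \<and> L j = v} =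
        {i. i < k \<and> L i = v} \<union> (\<lambda>i. i + k) ` {i. i < k \<and> L (i + k) = v}"
    proof (intro set_eqI iffI)
      fix j assume j: "j \<in> {j. j < 2 * k \<and> L j = v}"
      show "j \<in> {i. i < k \<and> L i = v} \<union> (\<lambda>i. i + k) ` {i. i < k \<and> L (i + k) = v}"
      proof (cases "j < k")
        case False
        then have "j = (j - k) + k" "j - k < k" using j by auto
        then show ?thesis using j by (metis (mono_tags, lifting) UnI2 imageI mem_Collect_eq)
      qed (use j in auto)
    qed auto
    have "D v = card {i. i < k \<and> L i = v} + card {i. i < k \<and> L (i + k) = v}"
      unfolding D_def split by (subst card_Un_disjoint) (auto simp: card_image)
    moreover have "card {i. i < k \<and> Q i} = (\<Sum>i<k. of_bool (Q i))" for Q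
      by (simp add: lessThan_def Int_def flip: sum.inter_filter) 
    ultimately show ?thesis
      unfolding end_degree_def by (simp add: sum.distrib)
  qed
  \<comment> \<open>At the start a path meets \<open>v\<close> only if one of its ends is there;
    each such path is charged to that end.\<close>
  have visits: "card {i. i < k \<and> v \<in> set (P i)} \<le> D v" if v: "v \<in> verts G" for v
  proof -
    have "{i. i < k \<and> v \<in> set (P i)} \<subseteq> (\<lambda>j. if j < k then j else j - k) ` {j. j < 2 * k \<and> L j = v}"
    proof
      fix i assume "i \<in> {i. i < k \<and> v \<in> set (P i)}"
      then have i: "i < k" "v = L i \<or> v = L (i + k)" using PV v by blast+
      then show "i \<in> (\<lambda>j. if j < k then j else j - k) ` {j. j < 2 * k \<and> L j = v}"
        by (auto intro: image_eqI[of _ _ i] image_eqI[of _ _ "i + k"])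
    qed
    then show ?thesis unfolding D_def by (rule surj_card_le[rotated]) simp
  qed
  obtain I s t where R: "realizable k (verts G) I s t"
    and deg_I: "\<And>v. v \<in> verts G \<Longrightarrow> end_degree I s t v = D v + 2 * m v"
  proof -
    have "card {i. i < k \<and> v \<in> set (P i)} + m v \<le> k" if "v \<in> verts G" for v
      using visits[OF that] m[OF that] by linarith
    from realizable_increase_degrees[OF T this] show ?thesis using that unfolding D by blast
  qed
  obtain s' t' where R': "realizable k (verts G) I s' t'"
    and bij: "bij_betw (\<lambda>r. {s' r, t' r}) I (edges G)"
  proof -
    \<comment> \<open>No strand is finished yet, so the matching starts with the empty set in place
      of \<open>F\<close>.\<close>
    have "\<exists>s' t'. realizable k (verts G) ({} \<union> I) s' t' \<and> (\<forall>r\<in>{}. s' r = s r \<and> t' r = t r) \<and>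
        bij_betw (\<lambda>r. {s' r, t' r}) I (edges G)"
    proof (rule realizable_matching)
      show "end_degree I s t v = card {e \<in> edges G. v \<in> e}" if "v \<in> verts G" for v
        using deg_I[OF that] m[OF that] unfolding degree_def by simp
    qed (use R k simple_graphD[OF G] in auto)
    then show ?thesis using that by auto
  qed
  obtain X' P' where "tangle k (verts G) I s' t' X' P'"
    using R' unfolding realizable_def by blast
  then interpret tangle k "verts G" I s' t' X' P' .
  have "X' r \<noteq> []" if "r \<in> I" for r
    using strand_owned[OF that] by auto
  then have "subdivision G (Graph (verts G \<union> (\<Union>r\<in>I. set (X' r)))
      ((edges G - (\<lambda>r. {s' r, t' r}) ` I) \<union> (\<Union>r\<in>I. ce (s' r # X' r @ [t' r]))))"
    using bij distinct_X X_V X_X by (intro subdivision_strands[OF G finite_I]) (auto simp: bij_betw_def)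
  then have "subdivision G (Graph (verts G \<union> (\<Union>r\<in>I. set (X' r)))
      (\<Union>r\<in>I. ce (s' r # X' r @ [t' r])))"
    using bij by (simp add: bij_betw_def)
  then show ?thesis
    using p2_top_le p2_le_tangle by (meson le_trans)
qed

text \<open>The odd vertices must take \<open>2 * m\<close> of the \<open>2 * k\<close> path ends.
  The other ends are placed in pairs on \<open>k - m\<close> new vertices that subdivide one edge;
  these have degree two and thus need exactly two ends and no visit in passing.\<close>

lemma p2_top_upper_bound:
  fixes G :: "'a::infinite graph"
  assumes G: "simple_graph G" and k: "2 \<le> k" and uv: "edges G \<noteq> {}"
    and deg: "\<And>v. v \<in> verts G \<Longrightarrow> degree G v \<le> 2 * k"
    and odd: "v_odd G = 2 * m" "m \<le> k"
  shows "p2_top G \<le> k"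
proof -
  obtain e where e: "e \<in> edges G" using uv by blast
  obtain u v where uvE: "{u, v} \<in> edges G"
    using simple_graphD(4)[OF G e] e by (auto simp: card_2_iff)
  have fin: "finite (verts G)" by (rule simple_graphD(1)[OF G])
  obtain zs where zs: "length zs = k - m" "distinct zs" "set zs \<inter> verts G = {}"
    using fresh_list[OF fin] by metis
  obtain os where os: "set os = {v \<in> verts G. odd (degree G v)}" "distinct os"
    using finite_distinct_list[of "{v \<in> verts G. odd (degree G v)}"] fin by auto
  have len_os: "length os = 2 * m"
    using distinct_card[OF os(2)] odd(1) unfolding os(1) v_odd_def by simp
  define H where "H = Graph (verts G \<union> set zs) ((edges G - {{u, v}}) \<union> ce (u # zs @ [v]))"
  have GH: "subdivision G H"
    unfolding H_def by (rule subdivision.step[OF subdivision.refl uvE zs(2,3)])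
  have H: "simple_graph H" "\<And>w. w \<in> verts G \<Longrightarrow> degree H w = degree G w"
    "\<And>w. w \<in> set zs \<Longrightarrow> degree H w = 2"
    unfolding H_def using subdivide_edge[OF G uvE zs(2,3)] by blast+
  have vH: "verts H = verts G \<union> set zs" by (simp add: H_def)
  \<comment> \<open>The \<open>k\<close> paths have \<open>2 * k\<close> ends: each odd vertex is used once, each vertex of \<open>zs\<close> twice.\<close>
  define L where "L j = (if j < 2 * m then os ! j else zs ! ((j - 2 * m) div 2))" for j
  have L_os: "L j \<in> set os" if "j < 2 * m" for j
    using that len_os by (simp add: L_def)
  have idx: "(j - 2 * m) div 2 < length zs" if "j < 2 * k" "\<not> j < 2 * m" for j
    using that zs(1) by linarith
  have L_zs: "L j \<in> set zs" if "j < 2 * k" "\<not> j < 2 * m" for j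
    using idx[OF that] that(2) by (simp add: L_def)
  have os_zs: "set os \<inter> set zs = {}" using os(1) zs(3) by blast
  have count_os: "card {j. j < 2 * k \<and> L j = w} = 1" if w: "w \<in> set os" for w
  proof -
    obtain p where p: "p < 2 * m" "w = os ! p" using w len_os by (metis in_set_conv_nth)
    have "{j. j < 2 * k \<and> L j = w} = {p}"
    proof (intro set_eqI iffI)
      fix j assume j: "j \<in> {j. j < 2 * k \<and> L j = w}"
      then have "j < 2 * m" using L_zs[of j] w os_zs by auto
      then show "j \<in> {p}"
        using j p os(2) len_os by (simp add: L_def nth_eq_iff_index_eq)
    qed (use p odd(2) in \<open>auto simp: L_def\<close>)
    then show ?thesis by simp
  qed
  have count_zs: "card {j. j < 2 * k \<and> L j = w} = 2" if w: "w \<in> set zs" for w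
  proof -
    obtain q where q: "q < length zs" "w = zs ! q" using w by (metis in_set_conv_nth)
    have "{j. j < 2 * k \<and> L j = w} = {2 * m + 2 * q, 2 * m + 2 * q + 1}"
    proof (intro set_eqI iffI)
      fix j assume j: "j \<in> {j. j < 2 * k \<and> L j = w}"
      then have nj: "\<not> j < 2 * m" using L_os[of j] w os_zs by auto
      then have "(j - 2 * m) div 2 = q"
        using j q idx[of j] zs(2) by (simp add: L_def nth_eq_iff_index_eq)
      then show "j \<in> {2 * m + 2 * q, 2 * m + 2 * q + 1}" using nj by auto
    qed (use q zs(1) in \<open>auto simp: L_def\<close>)
    then show ?thesis by simp
  qed
  have count_else: "card {j. j < 2 * k \<and> L j = w} = 0" if w: "w \<notin> set os" "w \<notin> set zs" for w
  proof -
    have "L j \<noteq> w" if "j < 2 * k" for j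
      using w L_os[of j] L_zs[of j] that by (cases "j < 2 * m") auto
    then have "{j. j < 2 * k \<and> L j = w} = {}" by blast
    then show ?thesis by (simp only: card.empty)
  qed
  have "p2_top H \<le> k"
  proof (rule p2_top_le_of_ends[OF H(1) k])
    show "L j \<in> verts H" if "j < 2 * k" for j
      using L_os[of j] L_zs[OF that] os(1) vH by auto
    \<comment> \<open>Two positions at distance \<open>k\<close> fall on different vertices of
      \<open>zs\<close> because \<open>2 \<le> k\<close>, whereas each vertex of \<open>zs\<close>
      takes two adjacent positions.\<close>
    show "L i \<noteq> L (i + k)" if i: "i < k" for i
    proof -
      consider "i + k < 2 * m" | "i < 2 * m" "\<not> i + k < 2 * m" | "\<not> i < 2 * m" by linarith
      then show ?thesis
      proof cases
        case 1
        then show ?thesis using os(2) len_os k i by (simp add: L_def nth_eq_iff_index_eq)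
      next
        case 2
        then show ?thesis using L_os[of i] L_zs[of "i + k"] os_zs i by auto
      next
        case 3
        then have "(i - 2 * m) div 2 \<noteq> (i + k - 2 * m) div 2" using k by linarith
        then show ?thesis
          using 3 idx[of i] idx[of "i + k"] i zs(2) by (simp add: L_def nth_eq_iff_index_eq)
      qed
    qed
    show "\<exists>l. degree H w = card {j. j < 2 * k \<and> L j = w} + 2 * l \<and>
        card {j. j < 2 * k \<and> L j = w} + l \<le> k" if w: "w \<in> verts H" for w
    proof -
      consider "w \<in> set os" | "w \<in> verts G" "w \<notin> set os" "w \<notin> set zs" | "w \<in> set zs"
        using w vH by blast
      then show ?thesis
      proof cases
        \<comment> \<open>One end and \<open>l\<close> visits in passing:
          \<open>2 * l + 1 \<le> 2 * k\<close> leaves room for \<open>l + 1\<close> paths.\<close>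
        case 1
        then have wG: "w \<in> verts G" "odd (degree G w)" using os(1) by auto
        then obtain l where l: "degree G w = 2 * l + 1" by (auto elim: oddE)
        then show ?thesis
          using deg[OF wG(1)] H(2)[OF wG(1)] count_os[OF 1] by (intro exI[of _ l]) simp
      next
        case 2
        then have "even (degree G w)" using os(1) by blast
        then obtain l where l: "degree G w = 2 * l" by (auto elim: evenE)
        then show ?thesis
          using deg[OF 2(1)] H(2)[OF 2(1)] unfolding count_else[OF 2(2,3)]
          by (intro exI[of _ l]) simp
      next
        \<comment> \<open>The two ends already give degree two; they lie on two paths, which
          \<open>2 \<le> k\<close> allows.\<close>
        case 3
        then show ?thesis
          using H(3)[OF 3] count_zs[OF 3] k by (intro exI[of _ 0]) simp
      qed
    qed
  qed
  \<comment> \<open>A subdivision attaining the minimum for \<open>H\<close> is also a subdivision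
    of \<open>G\<close>.\<close>
  moreover have "\<exists>K. subdivision H K \<and> p2 K = p2_top H"
  proof -
    have "\<exists>k K. subdivision H K \<and> p2 K = k" using subdivision.refl[of H] by blast
    from LeastI_ex[OF this] show ?thesis unfolding p2_top_def .
  qed
  then obtain K where "subdivision H K" "p2 K = p2_top H" by blast
  ultimately show ?thesis
    using p2_top_le[OF subdivision_trans[OF GH, of K]] by simp
qed

section \<open>The lower bound\<close>

text \<open>Both bounds compare the degree with the sum of the degrees of \<open>v\<close> in the
  paths. The sum counts the edges at \<open>v\<close> with multiplicity, so it is at least the
  degree and has the same parity. Each path contributes at most two, and an even number unless
  \<open>v\<close> is one of its ends.\<close>

lemma path_odd_cover_bounds:
  assumes "path_odd_cover G \<P>" and G: "simple_graph G"
  shows "degree G v \<le> 2 * card \<P>" and "v_odd G \<le> 2 * card \<P>"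
proof -
  have fin: "finite \<P>" and paths: "\<And>Q. Q \<in> \<P> \<Longrightarrow> is_path Q"
    and cover: "{e. odd (card {Q \<in> \<P>. e \<in> edges Q})} = edges G"
    using assms(1) unfolding path_odd_cover_def by blast+
  have "\<forall>Q\<in>\<P>. \<exists>xs. xs \<noteq> [] \<and> distinct xs \<and> Q = Graph (set xs) (ce xs)"
    using paths unfolding is_path_def by blast
  from bchoice[OF this] obtain l where
    l: "\<And>Q. Q \<in> \<P> \<Longrightarrow> l Q \<noteq> [] \<and> distinct (l Q) \<and> Q = Graph (set (l Q)) (ce (l Q))" by blast
  have edges_l: "edges Q = ce (l Q)" if "Q \<in> \<P>" for Q
    using l[OF that] by (metis graph.sel(2))
  have l_path: "l Q \<noteq> []" "distinct (l Q)" if "Q \<in> \<P>" for Q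
    using l[OF that] by blast+
  define c where "c e = card {Q \<in> \<P>. e \<in> edges Q}" for e
  define S where "S w = {e \<in> \<Union>(edges ` \<P>). w \<in> e}" for w
  have fin_S: "finite (S w)" for w
    using fin edges_l by (simp add: S_def)
  have deg: "degree G w = card {e \<in> S w. odd (c e)}" for w
  proof -
    have "e \<in> \<Union>(edges ` \<P>)" if "odd (c e)" for e
    proof -
      have "{Q \<in> \<P>. e \<in> edges Q} \<noteq> {}"
        using that unfolding c_def by (metis card.empty even_zero)
      then show ?thesis by blast
    qed
    then have "{e \<in> edges G. w \<in> e} = {e \<in> S w. odd (c e)}"
      unfolding cover[symmetric] c_def[symmetric] S_def by blast
    then show ?thesis by (simp add: degree_def)
  qed
  have sum_c: "(\<Sum>e\<in>S w. c e) = (\<Sum>Q\<in>\<P>. path_degree (l Q) w)" for w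
  proof -
    have "(\<Sum>e\<in>S w. c e) = (\<Sum>e\<in>S w. \<Sum>Q\<in>\<P>. of_bool (e \<in> edges Q))"
      using fin by (simp add: c_def Int_def)
    also have "\<dots> = (\<Sum>Q\<in>\<P>. \<Sum>e\<in>S w. of_bool (e \<in> edges Q))"
      by (rule sum.swap)
    also have "\<dots> = (\<Sum>Q\<in>\<P>. path_degree (l Q) w)"
    proof (rule sum.cong)
      fix Q assume Q: "Q \<in> \<P>"
      have "S w \<inter> {e. e \<in> edges Q} = {e \<in> ce (l Q). w \<in> e}"
        using Q edges_l[OF Q] unfolding S_def by blast
      then show "(\<Sum>e\<in>S w. of_bool (e \<in> edges Q)) = path_degree (l Q) w"
        using fin_S by (simp add: path_degree_def)
    qed simp
    finally show ?thesis .
  qed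
  \<comment> \<open>An edge of \<open>G\<close> has odd, hence positive, multiplicity.\<close>
  have "degree G v \<le> (\<Sum>e\<in>{e \<in> S v. odd (c e)}. c e)"
  proof -
    have "(\<Sum>e\<in>{e \<in> S v. odd (c e)}. 1) \<le> (\<Sum>e\<in>{e \<in> S v. odd (c e)}. c e)"
      by (rule sum_mono) (auto elim: oddE)
    then show ?thesis by (simp add: deg)
  qed
  also have "\<dots> \<le> (\<Sum>e\<in>S v. c e)"
    by (rule sum_mono2) (use fin_S in auto)
  also have "\<dots> \<le> (\<Sum>Q\<in>\<P>. 2)"
    unfolding sum_c by (rule sum_mono) (simp add: l_path path_degree_le)
  finally show "degree G v \<le> 2 * card \<P>" by simp
  have "{w \<in> verts G. odd (degree G w)} \<subseteq> (\<Union>Q\<in>\<P>. {hd (l Q), last (l Q)})"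
  proof
    fix w assume w: "w \<in> {w \<in> verts G. odd (degree G w)}"
    show "w \<in> (\<Union>Q\<in>\<P>. {hd (l Q), last (l Q)})"
    proof (rule ccontr)
      assume no_end: "w \<notin> (\<Union>Q\<in>\<P>. {hd (l Q), last (l Q)})"
      have "even (path_degree (l Q) w)" if "Q \<in> \<P>" for Q
        using path_degree_eq[OF l_path(2,1), OF that that, of w] no_end that by (auto split: if_splits)
      then have "even (\<Sum>Q\<in>\<P>. path_degree (l Q) w)" by (rule dvd_sum)
      \<comment> \<open>The degree is the number of odd summands in the total multiplicity, so both
        have the same parity.\<close>
      then have "even (degree G w)"
        unfolding sum_c[symmetric] deg even_sum_iff[OF fin_S] .
      then show False using w by blast
    qed
  qed
  then have "v_odd G \<le> card (\<Union>Q\<in>\<P>. {hd (l Q), last (l Q)})"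
    unfolding v_odd_def by (rule card_mono[rotated]) (use fin in simp)
  also have "\<dots> \<le> (\<Sum>Q\<in>\<P>. card {hd (l Q), last (l Q)})"
    by (rule card_UN_le[OF fin])
  also have "\<dots> \<le> (\<Sum>Q\<in>\<P>. 2)"
    by (rule sum_mono) (simp add: card_insert_if)
  finally show "v_odd G \<le> 2 * card \<P>" by simp
qed

text \<open>Provides a cover, so that the \<open>LEAST\<close> in the definition of
  \<open>p2\<close> is attained.\<close>

lemma path_odd_cover_single_edges:
  assumes G: "simple_graph G"
  shows "path_odd_cover G ((\<lambda>e. Graph e {e}) ` edges G)"
  unfolding path_odd_cover_def
proof (intro conjI ballI)
  show "finite ((\<lambda>e. Graph e {e}) ` edges G)" using simple_graphD(2)[OF G] by simp
  fix Q assume "Q \<in> (\<lambda>e. Graph e {e}) ` edges G"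
  then obtain e where e: "e \<in> edges G" "Q = Graph e {e}" by blast
  then show "verts Q \<subseteq> verts G" using simple_graphD(3)[OF G] by simp
  obtain a b where "e = {a, b}" "a \<noteq> b"
    using simple_graphD(4)[OF G e(1)] by (auto simp: card_2_iff)
  then show "is_path Q"
    unfolding is_path_def e(2) by (intro exI[of _ "[a, b]"]) auto
next
  have "card {Q \<in> (\<lambda>e. Graph e {e}) ` edges G. e \<in> edges Q} = of_bool (e \<in> edges G)" for e
  proof -
    have "{Q \<in> (\<lambda>e. Graph e {e}) ` edges G. e \<in> edges Q} =
        (if e \<in> edges G then {Graph e {e}} else {})"
      by auto
    then show ?thesis by simp
  qed
  then show "{e. odd (card {Q \<in> (\<lambda>e. Graph e {e}) ` edges G. e \<in> edges Q})} = edges G"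
    by simp
qed

lemma p2_attained:
  assumes "simple_graph G"
  obtains \<P> where "path_odd_cover G \<P>" "card \<P> = p2 G"
proof -
  have "\<exists>k \<P>. path_odd_cover G \<P> \<and> card \<P> = k"
    using path_odd_cover_single_edges[OF assms] by blast
  from LeastI_ex[OF this] show ?thesis
    using that unfolding p2_def by blast
qed

text \<open>Apply the bounds for covers to a subdivision attaining the minimum; it has the old
  degrees at the old vertices and at least as many odd vertices.\<close>

lemma p2_top_lower_bounds:
  fixes G :: "'a::infinite graph"
  assumes G: "simple_graph G"
  shows "v \<in> verts G \<Longrightarrow> degree G v \<le> 2 * p2_top G" and "v_odd G \<le> 2 * p2_top G"
proof -
  have "\<exists>k H. subdivision G H \<and> p2 H = k" using subdivision.refl[of G] by blast
  from LeastI_ex[OF this] obtain H where H: "subdivision G H" "p2 H = p2_top G"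
    unfolding p2_top_def by blast
  have sH: "simple_graph H" "verts G \<subseteq> verts H" "\<And>v. v \<in> verts G \<Longrightarrow> degree H v = degree G v"
    using subdivision_degree[OF H(1) G] by blast+
  obtain \<P> where P: "path_odd_cover H \<P>" "card \<P> = p2 H"
    using p2_attained[OF sH(1)] .
  show "degree G v \<le> 2 * p2_top G" if "v \<in> verts G"
    using path_odd_cover_bounds(1)[OF P(1) sH(1), of v] sH(3)[OF that] P(2) H(2) by simp
  have "{v \<in> verts G. odd (degree G v)} \<subseteq> {v \<in> verts H. odd (degree H v)}"
    using sH(2,3) by auto
  then have "v_odd G \<le> v_odd H"
    unfolding v_odd_def by (rule card_mono[rotated]) (simp add: simple_graphD(1)[OF sH(1)])
  then show "v_odd G \<le> 2 * p2_top G"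
    using path_odd_cover_bounds(2)[OF P(1) sH(1)] P(2) H(2) by simp
qed

text \<open>Handshake lemma: counting incidences by edges shows that the degree sum is even.\<close>

lemma even_v_odd:
  assumes G: "simple_graph G"
  shows "even (v_odd G)"
proof -
  note fin = simple_graphD(1,2)[OF G]
  have "(\<Sum>v\<in>verts G. degree G v) = (\<Sum>v\<in>verts G. \<Sum>e\<in>edges G. of_bool (v \<in> e))"
    using fin by (simp add: degree_def Int_def)
  also have "\<dots> = (\<Sum>e\<in>edges G. \<Sum>v\<in>verts G. of_bool (v \<in> e))"
    by (rule sum.swap)
  also have "\<dots> = (\<Sum>e\<in>edges G. 2)"
  proof (rule sum.cong)
    fix e assume e: "e \<in> edges G"
    have "verts G \<inter> {v. v \<in> e} = e" using simple_graphD(3)[OF G e] by blast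
    then show "(\<Sum>v\<in>verts G. of_bool (v \<in> e)) = (2 :: nat)"
      using fin(1) simple_graphD(4)[OF G e] by simp
  qed simp
  finally have "even (\<Sum>v\<in>verts G. degree G v)" by simp
  then show ?thesis unfolding v_odd_def even_sum_iff[OF fin(1)] .
qed

section \<open>Graphs of maximum degree two\<close>

text \<open>Path lengths are bounded by the number of vertices, and a neighbour of the last vertex
  outside a longest path would extend it.\<close>

lemma longest_path:
  assumes G: "simple_graph G" and a: "a \<in> verts G"
  obtains xs where "xs \<noteq> []" "distinct xs" "hd xs = a" "set xs \<subseteq> verts G" "ce xs \<subseteq> edges G"
    "\<And>w. {last xs, w} \<in> edges G \<Longrightarrow> w \<in> set xs"
proof -
  define Q where "Q xs \<longleftrightarrow> xs \<noteq> [] \<and> distinct xs \<and> hd xs = a \<and> set xs \<subseteq> verts G \<and> ce xs \<subseteq> edges G" for xs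
  have "Q [a]" using a by (simp add: Q_def)
  moreover have "length xs < Suc (card (verts G))" if "Q xs" for xs
    using that card_mono[OF simple_graphD(1)[OF G], of "set xs"] distinct_card[of xs]
    by (simp add: Q_def)
  ultimately obtain xs where xs: "Q xs" "\<And>ys. Q ys \<Longrightarrow> length ys \<le> length xs"
    using ex_has_greatest_nat[of Q "[a]" length "Suc (card (verts G))"] by blast
  have "w \<in> set xs" if w: "{last xs, w} \<in> edges G" for w
  proof (rule ccontr)
    assume "w \<notin> set xs"
    then have "Q (xs @ [w])"
      using xs(1) w simple_graphD(3)[OF G w] by (auto simp: Q_def ce_append)
    then show False using xs(2) by fastforce
  qed
  then show ?thesis using that xs(1) unfolding Q_def by blast
qed

text \<open>The component is read off a longest path started at an odd vertex if there is one.
  Its inner vertices have no further edges, so its last vertex either has no further edge or is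
  joined to the first vertex.\<close>

lemma path_or_cycle_component:
  assumes G: "simple_graph G" and ne: "verts G \<noteq> {}"
    and deg: "\<And>v. v \<in> verts G \<Longrightarrow> degree G v = 1 \<or> degree G v = 2"
  obtains K where "is_cycle K \<or> is_path K \<and> card {v \<in> verts K. odd (degree G v)} = 2"
    "verts K \<noteq> {}" "verts K \<subseteq> verts G" "edges K \<subseteq> edges G"
    "\<And>e. e \<in> edges G \<Longrightarrow> e \<in> edges K \<and> e \<subseteq> verts K \<or> e \<inter> verts K = {} \<and> e \<notin> edges K"
proof -
  obtain a where a: "a \<in> verts G" "degree G a = 1 \<or> (\<forall>v\<in>verts G. degree G v = 2)"
    using ne deg by blast
  obtain xs where xs: "xs \<noteq> []" "distinct xs" "hd xs = a" "set xs \<subseteq> verts G" "ce xs \<subseteq> edges G"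
    and max: "\<And>w. {last xs, w} \<in> edges G \<Longrightarrow> w \<in> set xs"
    using longest_path[OF G a(1)] by metis
  define b where "b = last xs"
  have b: "b \<in> set xs" using xs(1) by (simp add: b_def)
  have a_in: "a \<in> set xs" using xs(1,3) by (metis hd_in_set)
  have fin: "finite {e \<in> edges G. v \<in> e}" for v
    using simple_graphD(2)[OF G] by simp
  have edge_nonempty: "e \<noteq> {}" if "e \<in> edges G" for e
    using simple_graphD(4)[OF G that] by auto
  have edge_at: "\<exists>w. e = {v, w} \<and> w \<noteq> v" if e: "e \<in> edges G" "v \<in> e" for e v
    using simple_graphD(4)[OF G e(1)] e(2) unfolding card_2_iff by (metis doubleton_eq_iff insertE singletonD)
  \<comment> \<open>\<open>a\<close> has an edge, so a longest path from it does not stop at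
    once.\<close>
  have ab: "a \<noteq> b"
  proof
    assume "a = b"
    then have "xs = [a]"
      using xs(1-3) unfolding b_def by (cases xs rule: rev_cases) (auto simp: hd_append split: if_splits)
    have "{e \<in> edges G. a \<in> e} \<noteq> {}"
      using deg[OF a(1)] unfolding degree_def by (metis card.empty zero_neq_one zero_neq_numeral)
    then obtain e where e: "e \<in> edges G" "a \<in> e" by blast
    then obtain w where "e = {a, w}" "w \<noteq> a" using edge_at by blast
    then show False using max[of w] e(1) \<open>xs = [a]\<close> by simp
  qed
  have pd: "path_degree xs v = (if v \<in> {a, b} then 1 else 2)" if "v \<in> set xs" for v
    using path_degree_eq[OF xs(2,1), of v] that ab unfolding xs(3) b_def[symmetric] by auto
  \<comment> \<open>Counting criterion: if the edges of \<open>F\<close> at \<open>v\<close> already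
    reach the degree of \<open>v\<close>, there are no others.\<close>
  have full: "{e \<in> F. v \<in> e} = {e \<in> edges G. v \<in> e}"
    if "F \<subseteq> edges G" "degree G v \<le> card {e \<in> F. v \<in> e}" for F v
    using that fin unfolding degree_def by (intro card_seteq) auto
  have deg_le: "degree G v \<le> 2" if "v \<in> set xs" for v
    using deg[of v] xs(4) that by fastforce
  have inner: "e \<in> ce xs" if "v \<in> set xs" "v \<noteq> a" "v \<noteq> b" "e \<in> edges G" "v \<in> e" for v e
  proof -
    have "degree G v \<le> card {e \<in> ce xs. v \<in> e}"
      using pd[OF that(1)] that(2,3) deg_le[OF that(1)] unfolding path_degree_def by simp
    from full[OF xs(5) this] show ?thesis using that(4,5) by blast
  qed
  have deg_eq_1: "e \<in> ce xs" if "v \<in> {a, b}" "degree G v = 1" "e \<in> edges G" "v \<in> e" for v e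
  proof -
    have "degree G v \<le> card {e \<in> ce xs. v \<in> e}"
      using pd[of v] that(1,2) a_in b unfolding path_degree_def by fastforce
    from full[OF xs(5) this] show ?thesis using that(3,4) by blast
  qed
  \<comment> \<open>The other end lies on the path by maximality. If it is an inner vertex, all its
    edges are path edges; otherwise it is \<open>a\<close>.\<close>
  have end_edge: "e \<in> ce xs \<or> e = {a, b}" if e: "e \<in> edges G" "b \<in> e" for e
  proof -
    obtain w where w: "e = {b, w}" "w \<noteq> b" using edge_at[OF e] by blast
    then have "w \<in> set xs" using max[of w] e(1) by (simp add: b_def)
    then show ?thesis using inner[of w e] w e(1) by (cases "w = a") (auto simp: insert_commute)
  qed
  show ?thesis
  proof (cases "degree G a = 1")
    case True
    \<comment> \<open>A closing edge \<open>ab\<close> would be an edge at \<open>a\<close>, whose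
      only edge belongs to the path.\<close>
    have b_edges: "e \<in> ce xs" if "e \<in> edges G" "b \<in> e" for e
      using end_edge[OF that] deg_eq_1[of a e] True that by auto
    have all: "e \<in> ce xs" if "e \<in> edges G" "v \<in> e" "v \<in> set xs" for e v
      using inner[of v e] deg_eq_1[of a e] True b_edges[of e] that by (cases "v = a"; cases "v = b") auto
    have deg_xs: "degree G v = path_degree xs v" if "v \<in> set xs" for v
    proof -
      have "{e \<in> edges G. v \<in> e} = {e \<in> ce xs. v \<in> e}" using all[OF _ _ that] xs(5) by blast
      then show ?thesis by (simp add: degree_def path_degree_def)
    qed
    have "{v \<in> set xs. odd (degree G v)} = {a, b}"
      using deg_xs pd a_in b by (auto split: if_splits)
    then have odd: "card {v \<in> verts (Graph (set xs) (ce xs)). odd (degree G v)} = 2" using ab by simp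
    have path: "is_path (Graph (set xs) (ce xs))"
      unfolding is_path_def using xs(1,2) by blast
    show ?thesis
    proof (rule that[of "Graph (set xs) (ce xs)"])
      fix e assume e: "e \<in> edges G"
      show "e \<in> edges (Graph (set xs) (ce xs)) \<and> e \<subseteq> verts (Graph (set xs) (ce xs)) \<or>
        e \<inter> verts (Graph (set xs) (ce xs)) = {} \<and> e \<notin> edges (Graph (set xs) (ce xs))"
      proof (cases "e \<inter> set xs = {}")
        case True
        then have "e \<notin> ce xs"
          using ce_subset_set[of e xs] edge_nonempty[OF e] by blast
        then show ?thesis using True by simp
      next
        case False
        then show ?thesis using all[OF e] ce_subset_set[of e xs] by auto
      qed
    qed (use path odd xs in simp_all)
  next
    case False
    then have two: "degree G v = 2" if "v \<in> verts G" for v using a(2) that by blast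
    \<comment> \<open>The path uses only one of the two edges at \<open>b\<close>; by
      \<open>end_edge\<close> the other one closes the cycle.\<close>
    have "\<not> {e \<in> edges G. b \<in> e} \<subseteq> {e \<in> ce xs. b \<in> e}"
    proof
      assume "{e \<in> edges G. b \<in> e} \<subseteq> {e \<in> ce xs. b \<in> e}"
      then have "degree G b \<le> path_degree xs b"
        unfolding degree_def path_degree_def by (intro card_mono) auto
      then show False using pd[OF b] two[of b] b xs(4) by auto
    qed
    then obtain e where e: "e \<in> edges G" "b \<in> e" "e \<notin> ce xs" by blast
    then have ab_edge: "{a, b} \<in> edges G" "{a, b} \<notin> ce xs" using end_edge[of e] by auto
    define F where "F = insert {b, a} (ce xs)"
    have F: "F \<subseteq> edges G" using ab_edge(1) xs(5) by (auto simp: F_def insert_commute)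
    have all: "e \<in> F" if "e \<in> edges G" "v \<in> e" "v \<in> set xs" for e v
    proof -
      have "card {e \<in> F. v \<in> e} = path_degree xs v + of_bool (v \<in> {a, b})"
      proof -
        have "{e \<in> F. v \<in> e} = (if v \<in> {a, b} then insert {a, b} {e \<in> ce xs. v \<in> e} else {e \<in> ce xs. v \<in> e})"
          by (auto simp: F_def insert_commute)
        then show ?thesis using ab_edge(2) by (simp add: path_degree_def)
      qed
      then have "degree G v \<le> card {e \<in> F. v \<in> e}"
        using pd[OF that(3)] two[of v] xs(4) that(3) by auto
      from full[OF F this] show ?thesis using that(1,2) by blast
    qed
    have F_sub: "e \<subseteq> set xs" if "e \<in> F" for e
      using that ce_subset_set[of e xs] a_in b by (auto simp: F_def)
    \<comment> \<open>On a two-vertex path \<open>ab\<close> would be the path edge, but the closing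
      edge is not on the path.\<close>
    have "length xs \<ge> 3"
    proof (rule ccontr)
      assume "\<not> 3 \<le> length xs"
      moreover have "length xs \<noteq> 1" using ab xs(3) by (auto simp: b_def length_Suc_conv)
      moreover have "length xs \<noteq> 0" using xs(1) by simp
      ultimately have "length xs = 2" by linarith
      then have "xs = [a, b]" using xs(3) by (auto simp: b_def numeral_2_eq_2 length_Suc_conv)
      then show False using ab_edge(2) by simp
    qed
    then have cycle: "is_cycle (Graph (set xs) F)"
      unfolding is_cycle_def F_def using xs(2,3) b_def by blast
    show ?thesis
    proof (rule that[of "Graph (set xs) F"])
      fix e assume e: "e \<in> edges G"
      show "e \<in> edges (Graph (set xs) F) \<and> e \<subseteq> verts (Graph (set xs) F) \<or>
        e \<inter> verts (Graph (set xs) F) = {} \<and> e \<notin> edges (Graph (set xs) F)"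
      proof (cases "e \<inter> set xs = {}")
        case True
        then have "e \<notin> F"
          using F_sub[of e] edge_nonempty[OF e] by blast
        then show ?thesis using True by simp
      next
        case False
        then show ?thesis using all[OF e] F_sub[of e] by auto
      qed
    qed (use cycle F xs in simp_all)
  qed
qed

text \<open>Components are split off one by one. No edge leaves a component, so the other degrees
  stay the same. Each path component uses up two odd vertices, which bounds the number of
  paths.\<close>

lemma cycles_and_paths_decomposition:
  assumes "simple_graph G"
    and "\<And>v. v \<in> verts G \<Longrightarrow> degree G v = 1 \<or> degree G v = 2"
  shows "\<exists>\<C> \<Q>. (\<forall>C\<in>\<C>. is_cycle C) \<and> finite \<Q> \<and> 2 * card \<Q> \<le> v_odd G \<and> (\<forall>Q\<in>\<Q>. is_path Q) \<and>
    pairwise (\<lambda>A B. disjnt (verts A) (verts B)) (\<C> \<union> \<Q>) \<and>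
    G = Graph (\<Union>A\<in>\<C> \<union> \<Q>. verts A) (\<Union>A\<in>\<C> \<union> \<Q>. edges A)"
  using assms
proof (induction "card (verts G)" arbitrary: G rule: less_induct)
  case less
  note G = less.prems(1)
  show ?case
  proof (cases "verts G = {}")
    case True
    then have "edges G = {}" using simple_graphD(3,4)[OF G] by fastforce
    then have "G = Graph {} {}" using True by (metis graph.collapse)
    then show ?thesis by (intro exI[of _ "{}"]) simp
  next
    case False
    obtain K where K: "is_cycle K \<or> is_path K \<and> card {v \<in> verts K. odd (degree G v)} = 2"
      "verts K \<noteq> {}" "verts K \<subseteq> verts G" "edges K \<subseteq> edges G"
      and sep: "\<And>e. e \<in> edges G \<Longrightarrow> e \<in> edges K \<and> e \<subseteq> verts K \<or> e \<inter> verts K = {} \<and> e \<notin> edges K"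
      using path_or_cycle_component[OF G False less.prems(2)] by blast
    define H where "H = Graph (verts G - verts K) (edges G - edges K)"
    have H: "verts H = verts G - verts K" "edges H = edges G - edges K" by (simp_all add: H_def)
    have fin: "finite (verts G)" by (rule simple_graphD(1)[OF G])
    have sH: "simple_graph H"
      unfolding simple_graph_def H
    proof (intro conjI ballI)
      fix e assume e: "e \<in> edges G - edges K"
      then show "e \<subseteq> verts G - verts K" "card e = 2"
        using sep[of e] simple_graphD(3,4)[OF G, of e] by blast+
    qed (use fin in simp)
    have deg: "degree H v = degree G v" if "v \<in> verts H" for v
    proof -
      have "{e \<in> edges H. v \<in> e} = {e \<in> edges G. v \<in> e}"
        using that sep unfolding H by blast
      then show ?thesis by (simp add: degree_def)
    qed
    have smaller: "card (verts H) < card (verts G)"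
      unfolding H(1) by (rule psubset_card_mono[OF fin]) (use K(2,3) in blast)
    have degH: "degree H v = 1 \<or> degree H v = 2" if "v \<in> verts H" for v
      using deg[OF that] less.prems(2)[of v] that H(1) by simp
    obtain \<C> \<Q> where C: "\<forall>C\<in>\<C>. is_cycle C" and Q: "finite \<Q>" "2 * card \<Q> \<le> v_odd H" "\<forall>Q\<in>\<Q>. is_path Q"
      and pw: "pairwise (\<lambda>A B. disjnt (verts A) (verts B)) (\<C> \<union> \<Q>)"
      and H_eq: "H = Graph (\<Union>A\<in>\<C> \<union> \<Q>. verts A) (\<Union>A\<in>\<C> \<union> \<Q>. edges A)"
      using less.hyps[OF smaller sH degH] by blast
    have vH: "verts H = (\<Union>A\<in>\<C> \<union> \<Q>. verts A)" and eH: "edges H = (\<Union>A\<in>\<C> \<union> \<Q>. edges A)"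
      using arg_cong[OF H_eq, of verts] arg_cong[OF H_eq, of edges] by simp_all
    have "disjnt (verts K) (verts A)" if "A \<in> \<C> \<union> \<Q>" for A
      using that vH H(1) unfolding disjnt_def by blast
    then have pwK: "pairwise (\<lambda>A B. disjnt (verts A) (verts B)) (insert K (\<C> \<union> \<Q>))"
      using pw by (simp add: pairwise_insert disjnt_sym)
    have "verts G = verts K \<union> verts H" "edges G = edges K \<union> edges H"
      using K(3,4) H by blast+
    then have G_eq: "G = Graph (\<Union>A\<in>insert K (\<C> \<union> \<Q>). verts A) (\<Union>A\<in>insert K (\<C> \<union> \<Q>). edges A)"
      unfolding vH eH by (cases G) simp
    have odd_split: "v_odd G = card {v \<in> verts K. odd (degree G v)} + v_odd H"
    proof -
      have "{v \<in> verts G. odd (degree G v)} =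
          {v \<in> verts K. odd (degree G v)} \<union> {v \<in> verts H. odd (degree H v)}"
        using K(3) H(1) deg by auto
      moreover have "{v \<in> verts K. odd (degree G v)} \<inter> {v \<in> verts H. odd (degree H v)} = {}"
        using H(1) by blast
      moreover have "finite (verts K)" "finite (verts H)"
        using fin K(3) H(1) by (auto intro: finite_subset)
      ultimately show ?thesis unfolding v_odd_def by (simp add: card_Un_disjoint)
    qed
    from K(1) show ?thesis
    proof
      assume "is_cycle K"
      then show ?thesis
        using C Q pwK G_eq odd_split
        by (intro exI[of _ "insert K \<C>"] exI[of _ \<Q>] conjI) auto
    next
      assume K': "is_path K \<and> card {v \<in> verts K. odd (degree G v)} = 2"
      have "2 * card (insert K \<Q>) \<le> v_odd G"
        using Q(1,2) K' odd_split card_insert_le_m1[of "Suc (card \<Q>)" \<Q> K] by simp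
      then show ?thesis
        using C Q pwK G_eq K'
        by (intro exI[of _ \<C>] exI[of _ "insert K \<Q>"] conjI) auto
    qed
  qed
qed

section \<open>The minimum over all subdivisions\<close>

lemma delete_isolated_simps:
  "verts (delete_isolated G) = {v \<in> verts G. degree G v \<noteq> 0}"
  "edges (delete_isolated G) = edges G"
  "degree (delete_isolated G) v = degree G v"
  by (simp_all add: delete_isolated_def degree_def)

lemma simple_graph_delete_isolated:
  assumes G: "simple_graph G"
  shows "simple_graph (delete_isolated G)"
  unfolding simple_graph_def delete_isolated_simps
proof (intro conjI ballI subsetI)
  show "finite {v \<in> verts G. degree G v \<noteq> 0}" using simple_graphD(1)[OF G] by simp
  fix e assume e: "e \<in> edges G"
  show "card e = 2" by (rule simple_graphD(4)[OF G e])
  fix v assume v: "v \<in> e"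
  have "finite {e \<in> edges G. v \<in> e}" using simple_graphD(2)[OF G] by simp
  then have "degree G v \<noteq> 0" using e v by (auto simp: degree_def)
  then show "v \<in> {v \<in> verts G. degree G v \<noteq> 0}"
    using simple_graphD(3)[OF G e] v by blast
qed

text \<open>Without isolated vertices \<open>G\<close> consists of cycles and at most one path,
  since there are at most two odd vertices. With cycles excluded and an edge present, it is a single
  path, which covers \<open>G\<close> without any subdivision.\<close>

lemma p2_top_le_1:
  fixes G :: "'a::infinite graph"
  assumes G: "simple_graph G" and ne: "edges G \<noteq> {}"
    and deg: "\<And>v. v \<in> verts G \<Longrightarrow> degree G v \<le> 2" and odd: "v_odd G \<le> 2"
    and not_cycles: "\<not> cycles_and_at_most_one_path (delete_isolated G)"
  shows "p2_top G \<le> 1"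
proof -
  define D where "D = delete_isolated G"
  have D: "simple_graph D" unfolding D_def by (rule simple_graph_delete_isolated[OF G])
  \<comment> \<open>Isolated vertices have even degree, so deleting them does not affect the odd
    ones.\<close>
  have "{v \<in> verts D. odd (degree D v)} = {v \<in> verts G. odd (degree G v)}"
    unfolding D_def delete_isolated_simps by (auto elim: oddE)
  then have odd_D: "v_odd D \<le> 2" using odd by (simp add: v_odd_def)
  have "degree D v = 1 \<or> degree D v = 2" if "v \<in> verts D" for v
    using that deg[of v] unfolding D_def delete_isolated_simps by auto
  from cycles_and_paths_decomposition[OF D this] obtain \<C> \<Q> where C: "\<forall>C\<in>\<C>. is_cycle C"
    and Q: "finite \<Q>" "2 * card \<Q> \<le> v_odd D" "\<forall>Q\<in>\<Q>. is_path Q"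
    and pw: "pairwise (\<lambda>A B. disjnt (verts A) (verts B)) (\<C> \<union> \<Q>)"
    and D_eq: "D = Graph (\<Union>A\<in>\<C> \<union> \<Q>. verts A) (\<Union>A\<in>\<C> \<union> \<Q>. edges A)"
    by blast
  have card_Q: "card \<Q> \<le> 1" using Q(2) odd_D by linarith
  have "\<C> = {}"
  proof (rule ccontr)
    assume "\<C> \<noteq> {}"
    then have "cycles_and_at_most_one_path D"
      unfolding cycles_and_at_most_one_path_def using C Q(1,3) card_Q pw D_eq by blast
    then show False using not_cycles unfolding D_def by blast
  qed
  have eD: "edges D = edges G" "verts D \<subseteq> verts G" unfolding D_def delete_isolated_simps by auto
  have D_Q: "verts D = (\<Union>A\<in>\<Q>. verts A)" "edges D = (\<Union>A\<in>\<Q>. edges A)"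
    using arg_cong[OF D_eq, of verts] arg_cong[OF D_eq, of edges] unfolding \<open>\<C> = {}\<close> by simp_all
  have "card \<Q> \<noteq> 0" using ne D_Q(2) eD(1) Q(1) by auto
  then have "card \<Q> = 1" using card_Q by simp
  then obtain K where K: "\<Q> = {K}" by (rule card_1_singletonE)
  have "path_odd_cover G {K}"
    unfolding path_odd_cover_def
  proof (intro conjI ballI)
    have "{P \<in> {K}. e \<in> edges P} = (if e \<in> edges K then {K} else {})" for e by auto
    then have "card {P \<in> {K}. e \<in> edges P} = of_bool (e \<in> edges K)" for e by simp
    then show "{e. odd (card {P \<in> {K}. e \<in> edges P})} = edges G"
      using D_Q(2) eD(1) K by simp
  qed (use Q(3) D_Q(1) eD(2) K in auto)
  then have "p2 G \<le> 1" using p2_le by fastforce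
  then show ?thesis using p2_top_le[OF subdivision.refl[of G]] by simp
qed

section \<open>Maximum degree and the final formula\<close>

lemma degree_le_max_degree:
  "simple_graph G \<Longrightarrow> v \<in> verts G \<Longrightarrow> degree G v \<le> max_degree G"
  unfolding max_degree_def by (rule cSUP_upper) (auto dest: simple_graphD(1))

lemma max_degree_le:
  assumes "\<And>v. v \<in> verts G \<Longrightarrow> degree G v \<le> n"
  shows "max_degree G \<le> n"
proof (cases "verts G = {}")
  \<comment> \<open>\<open>cSUP_least\<close> needs a nonempty index set; without vertices the
    supremum is 0.\<close>
  case True
  then show ?thesis by (simp add: max_degree_def)
next
  case False
  then show ?thesis unfolding max_degree_def by (rule cSUP_least) (rule assms)
qed

lemma ceiling_half: "\<lceil>real n / 2\<rceil> = int ((n + 1) div 2)"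
  by (cases "even n") (auto elim!: evenE oddE simp: ceiling_eq_iff field_simps)

theorem theorem1p1:
  fixes G :: "'a::infinite graph"
  assumes "simple_graph G"
    and "\<not> cycles_and_at_most_one_path (delete_isolated G)"
  shows "real (p2_top G) =
    max (real (v_odd G) / 2) (real_of_int \<lceil>real (max_degree G) / 2\<rceil>)"
proof -
  note G = assms(1)
  obtain m where m: "v_odd G = 2 * m" using even_v_odd[OF G] by (auto elim: evenE)
  \<comment> \<open>The right-hand side as a natural number; \<open>(n + 1) div 2\<close> is the
    rounded-up half of \<open>n\<close>.\<close>
  define k where "k = max m ((max_degree G + 1) div 2)"
  have deg: "degree G v \<le> 2 * k" if "v \<in> verts G" for v
  proof -
    have "max_degree G \<le> 2 * ((max_degree G + 1) div 2)" by linarith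
    also have "\<dots> \<le> 2 * k" by (simp add: k_def)
    finally show ?thesis using degree_le_max_degree[OF G that] by linarith
  qed
  have "max_degree G \<le> 2 * p2_top G" "v_odd G \<le> 2 * p2_top G"
    using p2_top_lower_bounds[OF G] by (auto intro: max_degree_le)
  then have lower: "k \<le> p2_top G" unfolding k_def m by linarith
  have upper: "p2_top G \<le> k"
  proof (cases "edges G = {}")
    \<comment> \<open>An edgeless graph is covered by the empty collection.\<close>
    case True
    then have "path_odd_cover G {}" by (simp add: path_odd_cover_def)
    then have "p2 G = 0" using p2_le by fastforce
    then show ?thesis using p2_top_le[OF subdivision.refl[of G]] by simp
  next
    case False
    then obtain e where e: "e \<in> edges G" by blast
    have "e \<noteq> {}" using simple_graphD(4)[OF G e] by auto
    then obtain v where v: "v \<in> e" "v \<in> verts G"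
      using simple_graphD(3)[OF G e] by blast
    have "finite {e \<in> edges G. v \<in> e}" using simple_graphD(2)[OF G] by simp
    then have "degree G v \<noteq> 0" using e v(1) by (auto simp: degree_def)
    then have "k \<noteq> 0" using deg[OF v(2)] by linarith
    then consider "k = 1" | "2 \<le> k" by linarith
    then show ?thesis
    proof cases
      \<comment> \<open>A single path admits no tail swaps; here the exclusion of cycles gives the
        bound.\<close>
      case 1
      then have "v_odd G \<le> 2" using m by (simp add: k_def)
      then show ?thesis using p2_top_le_1[OF G False _ _ assms(2)] deg 1 by simp
    next
      case 2
      then show ?thesis using p2_top_upper_bound[OF G 2 False deg m] by (simp add: k_def)
    qed
  qed
  have "p2_top G = k" using lower upper by simp
  moreover have "real k = max (real (v_odd G) / 2) (real_of_int \<lceil>real (max_degree G) / 2\<rceil>)"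
    unfolding ceiling_half m k_def by simp
  ultimately show ?thesis by simp
qed

end
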